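(* Let $G$ be a connected, locally finite, $2$-ended, vertex-transitive graph which is not isomorphic to the two-way infinite path. Then its connective constant satisfies $\mu(G)\ge \phi$, where $\phi=\frac{1+\sqrt5}{2}$ is the golden mean.
   Context: A ray is a one-way infinite path; two rays are equivalent if no finite set of edges separates them; the equivalence classes are the ends, and $2$-ended means exactly two ends. Vertex-transitive means the automorphism group acts transitively on vertices. For a fixed vertex $o$, let $\sigma_n$ be the number of self-avoiding walks (walks visiting no vertex twice) of length $n$ starting at $o$; for a vertex-transitive graph the connective constant is $\mu(G)=\lim_{n\to\infty}\sigma_n^{1/n}$ (independent of $o$). *)

theory Defs
  imports Complex_Main
begin

text \<open>
  Graphs are simple and undirected, given by a (possibly infinite) vertex set \<open>V\<close> and a set \<open>E\<close>
  of two-element subsets of \<open>V\<close>.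
\<close>

definition simple_graph :: "'a set \<Rightarrow> 'a set set \<Rightarrow> bool" where
  "simple_graph V E \<longleftrightarrow> (\<forall>e\<in>E. \<exists>u\<in>V. \<exists>v\<in>V. u \<noteq> v \<and> e = {u, v})"

definition adj_rel :: "'a set set \<Rightarrow> ('a \<times> 'a) set" where
  "adj_rel E = {(u, v). {u, v} \<in> E}"

definition joined :: "'a set set \<Rightarrow> 'a \<Rightarrow> 'a \<Rightarrow> bool" where
  "joined E u v \<longleftrightarrow> (u, v) \<in> (adj_rel E)\<^sup>*"

definition connected_graph :: "'a set \<Rightarrow> 'a set set \<Rightarrow> bool" where
  "connected_graph V E \<longleftrightarrow> V \<noteq> {} \<and> (\<forall>u\<in>V. \<forall>v\<in>V. joined E u v)"

definition locally_finite_graph :: "'a set \<Rightarrow> 'a set set \<Rightarrow> bool" where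
  "locally_finite_graph V E \<longleftrightarrow> (\<forall>v\<in>V. finite {w \<in> V. {v, w} \<in> E})"

definition graph_iso :: "'a set \<Rightarrow> 'a set set \<Rightarrow> 'b set \<Rightarrow> 'b set set \<Rightarrow> ('a \<Rightarrow> 'b) \<Rightarrow> bool" where
  "graph_iso V E W F f \<longleftrightarrow>
     bij_betw f V W \<and> (\<forall>u\<in>V. \<forall>v\<in>V. {u, v} \<in> E \<longleftrightarrow> {f u, f v} \<in> F)"

definition isomorphic_graphs :: "'a set \<Rightarrow> 'a set set \<Rightarrow> 'b set \<Rightarrow> 'b set set \<Rightarrow> bool" where
  "isomorphic_graphs V E W F \<longleftrightarrow> (\<exists>f. graph_iso V E W F f)"

definition vertex_transitive :: "'a set \<Rightarrow> 'a set set \<Rightarrow> bool" where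
  "vertex_transitive V E \<longleftrightarrow> (\<forall>u\<in>V. \<forall>v\<in>V. \<exists>f. graph_iso V E V E f \<and> f u = v)"

definition two_way_path_edges :: "int set set" where
  "two_way_path_edges = {{i, i + 1} | i. True}"

definition rays :: "'a set \<Rightarrow> 'a set set \<Rightarrow> (nat \<Rightarrow> 'a) set" where
  "rays V E = {r. inj r \<and> range r \<subseteq> V \<and> (\<forall>i. {r i, r (Suc i)} \<in> E)}"

text \<open>
  A set \<open>F\<close> of edges separates two rays if, after deleting \<open>F\<close>, they have tails lying in different
  components.  (Tails have to be taken, since rays may meet in an initial part.)
\<close>

definition separates :: "'a set set \<Rightarrow> 'a set set \<Rightarrow> (nat \<Rightarrow> 'a) \<Rightarrow> (nat \<Rightarrow> 'a) \<Rightarrow> bool" where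
  "separates E F r s \<longleftrightarrow> (\<exists>N. \<forall>i\<ge>N. \<forall>j\<ge>N. \<not> joined (E - F) (r i) (s j))"

definition ray_equiv :: "'a set \<Rightarrow> 'a set set \<Rightarrow> ((nat \<Rightarrow> 'a) \<times> (nat \<Rightarrow> 'a)) set" where
  "ray_equiv V E = {(r, s). r \<in> rays V E \<and> s \<in> rays V E \<and>
     \<not> (\<exists>F. finite F \<and> F \<subseteq> E \<and> separates E F r s)}"

definition graph_ends :: "'a set \<Rightarrow> 'a set set \<Rightarrow> (nat \<Rightarrow> 'a) set set" where
  "graph_ends V E = rays V E // ray_equiv V E"

definition two_ended :: "'a set \<Rightarrow> 'a set set \<Rightarrow> bool" where
  "two_ended V E \<longleftrightarrow> card (graph_ends V E) = 2"

text \<open>A walk of length \<open>n\<close> is the list of its \<open>n + 1\<close> vertices.\<close>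

definition saws :: "'a set \<Rightarrow> 'a set set \<Rightarrow> 'a \<Rightarrow> nat \<Rightarrow> 'a list set" where
  "saws V E a n = {p. length p = Suc n \<and> hd p = a \<and> set p \<subseteq> V \<and> distinct p \<and>
     successively (\<lambda>u v. {u, v} \<in> E) p}"

definition connective_constant :: "'a set \<Rightarrow> 'a set set \<Rightarrow> 'a \<Rightarrow> real" where
  "connective_constant V E a = lim (\<lambda>n. root n (real (card (saws V E a n))))"

lemma joined_refl: "joined E u u"
  by (simp add: joined_def)

lemma joined_sym: "joined E u v \<Longrightarrow> joined E v u"
proof -
  have "sym (adj_rel E)"
    by (auto simp: sym_def adj_rel_def insert_commute)
  then show "joined E u v \<Longrightarrow> joined E v u"
    unfolding joined_def by (meson sym_rtrancl symD)
qed

lemma joined_trans: "joined E u v \<Longrightarrow> joined E v w \<Longrightarrow> joined E u w"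
  unfolding joined_def by (rule rtrancl_trans)

lemma ray_tail_joined:
  assumes r: "r \<in> rays V E" and F: "finite F"
  obtains N where "\<And>i j. i \<ge> N \<Longrightarrow> j \<ge> N \<Longrightarrow> joined (E - F) (r i) (r j)"
proof -
  have injr: "inj r" and edge: "\<And>i. {r i, r (Suc i)} \<in> E"
    using r by (auto simp: rays_def)
  have "inj (\<lambda>i. {r i, r (Suc i)})"
  proof (rule injI)
    fix i j assume "{r i, r (Suc i)} = {r j, r (Suc j)}"
    then have "r i = r j \<or> (r i = r (Suc j) \<and> r (Suc i) = r j)"
      by (auto simp: doubleton_eq_iff)
    then show "i = j" using injr by (simp add: inj_eq) linarith
  qed
  then have "finite ((\<lambda>i. {r i, r (Suc i)}) -` F)"
    using F by (simp add: finite_vimageI)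
  then obtain N where N: "\<forall>i\<in>(\<lambda>i. {r i, r (Suc i)}) -` F. i < N"
    using finite_nat_set_iff_bounded by blast
  have step: "joined (E - F) (r N) (r (N + k))" for k
  proof (induction k)
    case 0
    show ?case by (simp add: joined_refl)
  next
    case (Suc k)
    have "{r (N + k), r (Suc (N + k))} \<in> E - F"
      using N edge by force
    then have "joined (E - F) (r (N + k)) (r (N + Suc k))"
      by (auto simp: joined_def adj_rel_def)
    with Suc.IH show ?case by (rule joined_trans)
  qed
  have "joined (E - F) (r i) (r j)" if "i \<ge> N" "j \<ge> N" for i j
    using step[of "i - N"] step[of "j - N"] that
    by (metis joined_sym joined_trans le_add_diff_inverse)
  then show ?thesis by (rule that)
qed

lemma equiv_ray_equiv: "equiv (rays V E) (ray_equiv V E)"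
proof (rule equivI)
  show "ray_equiv V E \<subseteq> rays V E \<times> rays V E"
    by (auto simp: ray_equiv_def)
  show "refl_on (rays V E) (ray_equiv V E)"
    by (auto simp: refl_on_def ray_equiv_def separates_def intro: joined_refl)
  show "sym (ray_equiv V E)"
    unfolding sym_def ray_equiv_def separates_def by (auto dest: joined_sym) (meson joined_sym)+
  show "trans (ray_equiv V E)"
  proof (rule transI)
    fix r s t assume rs: "(r, s) \<in> ray_equiv V E" and st: "(s, t) \<in> ray_equiv V E"
    have "\<not> separates E F r t" if F: "finite F" "F \<subseteq> E" for F
    proof
      assume "separates E F r t"
      then obtain N where N: "\<And>i j. i \<ge> N \<Longrightarrow> j \<ge> N \<Longrightarrow> \<not> joined (E - F) (r i) (t j)"
        by (auto simp: separates_def)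
      have "s \<in> rays V E" using rs by (simp add: ray_equiv_def)
      then obtain M where M: "\<And>i j. i \<ge> M \<Longrightarrow> j \<ge> M \<Longrightarrow> joined (E - F) (s i) (s j)"
        using ray_tail_joined F(1) by metis
      have "\<not> separates E F r s" "\<not> separates E F s t"
        using rs st F by (auto simp: ray_equiv_def)
      then obtain i j k l where "i \<ge> max M N" "j \<ge> max M N" "k \<ge> max M N" "l \<ge> max M N"
        and "joined (E - F) (r i) (s j)" "joined (E - F) (s k) (t l)"
        unfolding separates_def by meson
      then show False
        using N[of i l] M[of j k] by (auto dest: joined_trans)
    qed
    then show "(r, t) \<in> ray_equiv V E"
      using rs st by (auto simp: ray_equiv_def)
  qed
qed

end

(*
Two-endedness provides, for every vertex v, finitely many cuts of bounded radius around v separating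
the two ends; comparing the (regularised) sizes of their sides gives a function h on the vertices
that every automorphism changes only by a sign and a constant, and that is unbounded below. Either
no automorphism flips the sign, or h can be corrected to be harmonic. In both cases every vertex has
a neighbour above it and one below it, and the walks that climb along h are counted:
  - a neighbour at the same level allows the steps "up" and "level, up", and 1/phi + 1/phi^2 = 1;
  - two upward neighbours everywhere give 2^n walks;
  - one upward and one downward neighbour and nothing else give the two-way infinite path;
  - otherwise vertices with d - 1 upward edges alternate with vertices with a single upward edge.
    For d >= 4 this gives (d - 1)^(n/2) walks. For d = 3 the edges have heights a, b and
    a + b; if b < a, a shift of h makes the b-edges level, and if a = b, the walks may also zigzag,
    with 2/phi^2 + 2/phi^4 > 1.
*)

theory Submission
  imports Defs "HOL-Library.Sublist"
begin

section \<open>Growth rates and the golden mean\<close>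

text \<open>A single cut gives no canonical height, because automorphisms move it. The sum therefore
  runs over all cuts of bounded radius around a vertex: a finite family, carried by automorphisms to
  the family of the image vertex (up to complements) and of the same size everywhere. The equal size
  makes the additive constant of an automorphism the same at all vertices. The obstacle is an
  automorphism that exchanges the ends. It turns up into down, so the number of upward neighbours
  may vary with the vertex. Harmonicity settles this: at a vertex with one downward edge and several
  upward ones, the downward edge is as high as the upward ones together, hence higher than each of
  them, and this tells the two kinds of vertices apart. Equations such as 1/phi + 1/phi^2 = 1 are
  about weights: a block of length l weighs phi^(-l), and a prefix-free choice of blocks of total
  weight at least 1 at every start gives at least a constant times phi^n walks. Self-avoidance comes
  from climbing.\<close>

lemma fekete_limit:
  fixes u :: "nat \<Rightarrow> real"
  assumes sub: "\<And>m n. u (m + n) \<le> u m + u n" and pos: "\<And>n. 0 \<le> u n"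
  shows "convergent (\<lambda>n. u n / real n)"
proof -
  define L where "L = Inf ((\<lambda>n. u n / real n) ` {1..})"
  have bdd: "bdd_below ((\<lambda>n. u n / real n) ` {1..})"
    by (rule bdd_belowI[of _ 0]) (auto simp: pos)
  have lower: "L \<le> u n / real n" if "n \<ge> 1" for n
    unfolding L_def using that by (intro cInf_lower bdd) auto
  have mult: "u (q * m + r) \<le> real q * u m + u r" for q m r
  proof (induction q)
    case (Suc q)
    have "u (Suc q * m + r) \<le> u m + u (q * m + r)"
      using sub[of m "q * m + r"] by (simp add: add.assoc)
    with Suc show ?case by (simp add: algebra_simps)
  qed simp
  have "(\<lambda>n. u n / real n) \<longlonglongrightarrow> L"
  proof (rule LIMSEQ_I)
    fix e :: real assume e: "0 < e"
    have "\<exists>x\<in>(\<lambda>n. u n / real n) ` {1..}. x < L + e / 2"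
      using e bdd unfolding L_def by (subst cInf_less_iff[symmetric]) auto
    then obtain m where m: "m \<ge> 1" "u m / real m < L + e / 2" by auto
    \<comment> \<open>The remainders \<open>n mod m\<close> take finitely many values, so one
      constant bounds \<open>u\<close> on all of them, and it vanishes after division by
      \<open>n\<close>.\<close>
    define C where "C = (\<Sum>r<m. u r)"
    have C: "u r \<le> C" if "r < m" for r
      unfolding C_def using that pos by (intro member_le_sum) auto
    have C0: "0 \<le> C" unfolding C_def by (intro sum_nonneg pos)
    obtain N where N: "real N > 2 * C / e" using reals_Archimedean2 by blast
    have "norm (u n / real n - L) < e" if n: "n \<ge> max 1 N" for n
    proof -
      have n0: "0 < real n" using n by simp
      have "u n = u ((n div m) * m + n mod m)" by simp
      also have "\<dots> \<le> real (n div m) * u m + u (n mod m)" by (rule mult)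
      also have "\<dots> \<le> real (n div m) * u m + C" using C m by simp
      also have "real (n div m) * u m \<le> real n / real m * u m"
        by (intro mult_right_mono pos of_nat_div_le_of_nat)
      finally have "u n / real n \<le> (real n / real m * u m + C) / real n"
        using n0 by (simp add: divide_right_mono)
      also have "\<dots> = u m / real m + C / real n"
        using n0 m by (simp add: field_simps)
      finally have 1: "u n / real n \<le> u m / real m + C / real n" .
      have "2 * C / e < real n" using N n by (smt (verit) max.bounded_iff of_nat_mono)
      then have "C / real n < e / 2" using n0 e by (simp add: field_simps)
      moreover have "L \<le> u n / real n" using lower n by simp
      ultimately show ?thesis using 1 m(2) unfolding real_norm_def by linarith
    qed
    then show "\<exists>no. \<forall>n\<ge>no. norm (u n / real n - L) < e" by blast
  qed
  then show ?thesis by (rule convergentI)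
qed

text \<open>Fekete's lemma for the logarithm. Convergence has to be proved because
  \<open>connective_constant\<close> is a \<open>lim\<close>, an unspecified value for a divergent
  sequence.\<close>

lemma root_submultiplicative_convergent:
  fixes s :: "nat \<Rightarrow> real"
  assumes sub: "\<And>m n. s (m + n) \<le> s m * s n" and ge: "\<And>n. 1 \<le> s n"
  shows "convergent (\<lambda>n. root n (s n))"
proof -
  have "convergent (\<lambda>n. ln (s n) / real n)"
  proof (rule fekete_limit)
    fix m n
    have "ln (s (m + n)) \<le> ln (s m * s n)"
      using sub ge[of "m + n"] by (intro ln_mono) (auto intro: less_le_trans[OF zero_less_one])
    also have "\<dots> = ln (s m) + ln (s n)"
      using ge[of m] ge[of n] by (intro ln_mult_pos) auto
    finally show "ln (s (m + n)) \<le> ln (s m) + ln (s n)" .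
  qed (use ge in auto)
  then obtain L where "(\<lambda>n. ln (s n) / real n) \<longlonglongrightarrow> L" by (auto simp: convergent_def)
  then have "(\<lambda>n. exp (ln (s n) / real n)) \<longlonglongrightarrow> exp L" by (rule tendsto_exp)
  moreover have "\<forall>\<^sub>F n in sequentially. exp (ln (s n) / real n) = root n (s n)"
    using eventually_gt_at_top[of 0]
  proof eventually_elim
    case (elim n)
    have "0 < s n" using ge[of n] by linarith
    with elim show ?case by (simp add: root_powr_inverse powr_def divide_inverse_commute)
  qed
  ultimately have "(\<lambda>n. root n (s n)) \<longlonglongrightarrow> exp L" by (rule Lim_transform_eventually)
  then show ?thesis by (rule convergentI)
qed

text \<open>Since \<open>root n c\<close> tends to 1, a constant factor is harmless. This absorbs
  the factor lost in the block count.\<close>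

lemma lim_root_ge:
  fixes s :: "nat \<Rightarrow> real"
  assumes conv: "convergent (\<lambda>n. root n (s n))"
    and c: "0 < c" and x: "0 < x" and ge: "\<And>n. c * x ^ n \<le> s n"
  shows "x \<le> lim (\<lambda>n. root n (s n))"
proof (rule LIMSEQ_le)
  show "(\<lambda>n. root n (s n)) \<longlonglongrightarrow> lim (\<lambda>n. root n (s n))"
    using conv by (simp add: convergent_LIMSEQ_iff)
  show "(\<lambda>n. root n c * x) \<longlonglongrightarrow> x"
    using tendsto_mult[OF LIMSEQ_root_const[OF c] tendsto_const[of x]] by simp
  have "root n c * x \<le> root n (s n)" if "n \<ge> 1" for n
  proof -
    have "root n c * x = root n (c * x ^ n)"
      using that x by (simp add: real_root_mult real_root_power_cancel)
    also have "\<dots> \<le> root n (s n)" using ge that by (intro real_root_le_mono) auto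
    finally show ?thesis .
  qed
  then show "\<exists>N. \<forall>n\<ge>N. root n c * x \<le> root n (s n)" by blast
qed

section \<open>Arithmetic of the golden mean\<close>

definition golden :: real where "golden = (1 + sqrt 5) / 2"

lemma golden_square: "golden\<^sup>2 = golden + 1"
  by (simp add: golden_def power2_eq_square field_simps)

lemma golden_power4: "golden ^ 4 = 3 * golden + 2"
proof -
  have sq: "golden * golden = golden + 1" using golden_square by (simp add: power2_eq_square)
  have "golden ^ 4 = (golden * golden) * (golden * golden)" by (simp add: power4_eq_xxxx)
  also have "\<dots> = golden * golden + 2 * golden + 1"
    unfolding sq by (simp add: algebra_simps sq)
  finally show ?thesis using sq by simp
qed

text \<open>Quotients of consecutive Fibonacci numbers. The upper one is sharp enough for
  \<open>growth_zigzag\<close>.\<close>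

lemma golden_bounds: "8 / 5 < golden" "golden < 13 / 8"
proof -
  have "11 / 5 < sqrt 5" by (rule real_less_rsqrt) (simp add: power2_eq_square)
  then show "8 / 5 < golden" by (simp add: golden_def)
  have "sqrt 5 < 9 / 4" by (rule real_less_lsqrt) (simp_all add: power2_eq_square)
  then show "golden < 13 / 8" by (simp add: golden_def)
qed

section \<open>Counting self-avoiding walks by blocks\<close>

lemma successively_butlast_append:
  assumes "successively P (s # ys @ [t])" "successively P q" "hd q = t" "q \<noteq> []"
  shows "successively P (s # ys @ q)"
proof -
  have "successively P ((s # ys) @ q)"
    using assms successively_append_iff[of P "s # ys" "[t]"] successively_append_iff[of P "s # ys" q]
    by auto
  then show ?thesis by simp
qed

section \<open>Automorphisms and self-avoiding walks of transitive graphs\<close>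

locale transitive_graph =
  fixes V :: "'a set" and E :: "'a set set"
  assumes simple: "simple_graph V E"
    and conn: "connected_graph V E"
    and lf: "locally_finite_graph V E"
    and vt: "vertex_transitive V E"
begin

abbreviation nb :: "'a \<Rightarrow> 'a set" where "nb v \<equiv> {w. {v, w} \<in> E}"

abbreviation aut :: "('a \<Rightarrow> 'a) \<Rightarrow> bool" where "aut \<equiv> graph_iso V E V E"

abbreviation saw :: "'a \<Rightarrow> nat \<Rightarrow> 'a list set" where "saw \<equiv> saws V E"

lemma edgeD: "{u, v} \<in> E \<Longrightarrow> u \<in> V \<and> v \<in> V \<and> u \<noteq> v"
  using simple unfolding simple_graph_def by (metis doubleton_eq_iff)

lemma edge_sym: "{u, v} \<in> E \<longleftrightarrow> {v, u} \<in> E"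
  by (simp add: insert_commute)

lemma edgeE: assumes "e \<in> E" obtains u v where "e = {u, v}" "u \<in> V" "v \<in> V" "u \<noteq> v"
  using assms simple unfolding simple_graph_def by blast

lemma finite_nb: "finite (nb v)"
proof (cases "v \<in> V")
  case True
  have "nb v = {w \<in> V. {v, w} \<in> E}" using edgeD by blast
  with True lf show ?thesis by (simp add: locally_finite_graph_def)
next
  case False
  then have "nb v = {}" using edgeD by blast
  then show ?thesis by simp
qed

lemma V_nonempty: "V \<noteq> {}"
  using conn by (simp add: connected_graph_def)

lemma connected_induct [consumes 2, case_names base step]:
  assumes "u \<in> V" "v \<in> V" and base: "P u"
    and step: "\<And>x y. {x, y} \<in> E \<Longrightarrow> P x \<Longrightarrow> P y"
  shows "P v"
proof -
  have "(u, v) \<in> (adj_rel E)\<^sup>*" using assms conn by (auto simp: connected_graph_def joined_def)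
  then show ?thesis
    by (induction rule: rtrancl_induct) (auto simp: base adj_rel_def intro: step)
qed

lemma aut_ex: "u \<in> V \<Longrightarrow> v \<in> V \<Longrightarrow> \<exists>g. aut g \<and> g u = v"
  using vt by (auto simp: vertex_transitive_def)

lemma aut_in: "aut g \<Longrightarrow> v \<in> V \<Longrightarrow> g v \<in> V"
  by (auto simp: graph_iso_def bij_betw_def)

lemma aut_inj: "aut g \<Longrightarrow> inj_on g V"
  by (auto simp: graph_iso_def bij_betw_def)

lemma aut_surj: "aut g \<Longrightarrow> g ` V = V"
  by (auto simp: graph_iso_def bij_betw_def)

lemma aut_edge: "aut g \<Longrightarrow> u \<in> V \<Longrightarrow> v \<in> V \<Longrightarrow> {g u, g v} \<in> E \<longleftrightarrow> {u, v} \<in> E"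
  by (auto simp: graph_iso_def)

lemma aut_nb: assumes g: "aut g" and v: "v \<in> V" shows "nb (g v) = g ` nb v"
proof
  show "nb (g v) \<subseteq> g ` nb v"
  proof
    fix w assume w: "w \<in> nb (g v)"
    then have "w \<in> g ` V" using edgeD[of "g v" w] aut_surj[OF g] by simp
    then show "w \<in> g ` nb v" using w aut_edge[OF g v] by auto
  qed
qed (use aut_edge[OF g v] edgeD in blast)

lemma saws_0: "v \<in> V \<Longrightarrow> saw v 0 = {[v]}"
  by (auto simp: saws_def length_Suc_conv)

lemma finite_saws: "v \<in> V \<Longrightarrow> finite (saw v n)"
proof (induction n arbitrary: v)
  case 0
  then show ?case by (simp add: saws_0)
next
  case (Suc n)
  have "saw v (Suc n) \<subseteq> (\<Union>w\<in>nb v. (#) v ` saw w n)"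
  proof
    fix p assume p: "p \<in> saw v (Suc n)"
    then obtain w q where "p = v # w # q"
      by (auto simp: saws_def length_Suc_conv)
    with p have "w \<in> nb v" "w # q \<in> saw w n" "p = v # (w # q)"
      by (auto simp: saws_def)
    then show "p \<in> (\<Union>w\<in>nb v. (#) v ` saw w n)" by blast
  qed
  moreover have "finite (\<Union>w\<in>nb v. (#) v ` saw w n)"
    using finite_nb edgeD Suc.IH by blast
  ultimately show ?case by (rule finite_subset)
qed

lemma card_saws_le: assumes "u \<in> V" "v \<in> V" shows "card (saw u n) \<le> card (saw v n)"
proof -
  obtain g where g: "aut g" "g u = v" using aut_ex assms by blast
  show ?thesis
  proof (rule card_inj_on_le)
    show "inj_on (map g) (saw u n)"
      proof (rule inj_onI)
      fix x y assume xy: "x \<in> saw u n" "y \<in> saw u n" "map g x = map g y"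
      have "inj_on g (set x \<union> set y)"
        using xy aut_inj[OF g(1)] by (auto simp: saws_def intro: inj_on_subset)
      with xy(3) show "x = y" by (rule map_inj_on)
    qed
    show "map g ` saw u n \<subseteq> saw v n"
    proof
      fix q assume "q \<in> map g ` saw u n"
      then obtain p where p: "p \<in> saw u n" "q = map g p" by blast
      then have "successively (\<lambda>x y. {g x, g y} \<in> E) p"
        using aut_edge[OF g(1)] by (auto simp: saws_def intro: successively_mono)
      moreover have "p \<noteq> []" using p by (auto simp: saws_def)
      moreover have "inj_on g (set p)"
        using p aut_inj[OF g(1)] by (auto simp: saws_def intro: inj_on_subset)
      ultimately show "q \<in> saw v n"
        using p g aut_in[OF g(1)]
        by (auto simp: saws_def successively_map distinct_map hd_map)
    qed
  qed (use assms finite_saws in auto)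
qed

lemma card_saws_eq: "u \<in> V \<Longrightarrow> v \<in> V \<Longrightarrow> card (saw u n) = card (saw v n)"
  by (simp add: card_saws_le le_antisym)

lemma card_saws_submult:
  assumes v: "v \<in> V" shows "card (saw v (m + n)) \<le> card (saw v m) * card (saw v n)"
proof -
  let ?S = "SIGMA q : saw v m. saw (last q) n"
  have last: "last q \<in> V" if "q \<in> saw v m" for q
    using that last_in_set[of q] by (fastforce simp: saws_def)
  have "card (saw v (m + n)) \<le> card ?S"
  proof (rule card_inj_on_le)
    \<comment> \<open>The two pieces share the vertex at index \<open>m\<close>, because a walk of
      length \<open>m\<close> has \<open>Suc m\<close> vertices. The second piece starts where the
      first ends, whence the dependent sum \<open>?S\<close>.\<close>
    show "inj_on (\<lambda>p. (take (Suc m) p, drop m p)) (saw v (m + n))"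
    proof (rule inj_onI, clarsimp)
      fix p q assume eq: "take (Suc m) p = take (Suc m) q" "drop m p = drop m q"
      then have "take m p = take m q" by (metis min.absorb1 le_SucI order_refl take_take)
      with eq show "p = q" by (metis append_take_drop_id)
    qed
    show "(\<lambda>p. (take (Suc m) p, drop m p)) ` saw v (m + n) \<subseteq> ?S"
    proof clarify
      fix p assume p: "p \<in> saw v (m + n)"
      then have len: "length p = Suc (m + n)" by (simp add: saws_def)
      have "hd (take (Suc m) p) = v" using p by (simp add: saws_def hd_take)
      moreover have "hd (drop m p) = last (take (Suc m) p)"
        using len by (simp add: hd_drop_conv_nth take_Suc_conv_app_nth)
      moreover have "successively (\<lambda>u v. {u, v} \<in> E) (take (Suc m) p)"
        "successively (\<lambda>u v. {u, v} \<in> E) (drop m p)"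
        using p by (metis (mono_tags, lifting) append_take_drop_id mem_Collect_eq saws_def successively_append_iff)+
      ultimately show "take (Suc m) p \<in> saw v m \<and> drop m p \<in> saw (last (take (Suc m) p)) n"
        using p by (auto simp: saws_def dest: in_set_takeD in_set_dropD)
    qed
    show "finite ?S" using last finite_saws v by blast
  qed
  also have "\<dots> = (\<Sum>q\<in>saw v m. card (saw (last q) n))"
    by (intro card_SigmaI ballI finite_saws v last)
  also have "\<dots> = (\<Sum>q\<in>saw v m. card (saw v n))"
    by (intro sum.cong refl card_saws_eq v last)
  also have "\<dots> = card (saw v m) * card (saw v n)" by simp
  finally show ?thesis .
qed

text \<open>The divisor is the slack of the block count: blocks have length at most 4, and for
  \<open>n < 4\<close> the bound asks for no more than one walk. One start vertex is enough by
  transitivity.\<close>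

definition golden_growth :: bool where
  "golden_growth \<longleftrightarrow> (\<exists>s\<in>V. \<forall>n. golden ^ n / golden ^ 4 \<le> real (card (saw s n)))"

lemma golden_growthD:
  assumes "golden_growth" and v: "v \<in> V"
  shows "golden \<le> connective_constant V E v"
proof -
  have ge: "golden ^ n / golden ^ 4 \<le> real (card (saw v n))" for n
    using assms card_saws_eq[of _ v n] unfolding golden_growth_def by metis
  have gpos: "0 < golden" using golden_bounds by linarith
  have one: "1 \<le> real (card (saw v n))" for n
  proof -
    have "0 < golden ^ n / golden ^ 4" using gpos by simp
    then have "0 < card (saw v n)" using ge[of n] by (metis less_le_trans of_nat_0_less_iff)
    then show ?thesis by simp
  qed
  show ?thesis unfolding connective_constant_def
  proof (rule lim_root_ge)
    show "convergent (\<lambda>n. root n (real (card (saw v n))))"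
    proof (rule root_submultiplicative_convergent)
      show "real (card (saw v (m + n))) \<le> real (card (saw v m)) * real (card (saw v n))" for m n
        using card_saws_submult[OF v, of m n] by (metis of_nat_le_iff of_nat_mult)
    qed (rule one)
    show "1 / golden ^ 4 * golden ^ n \<le> real (card (saw v n))" for n using ge[of n] by simp
  qed (use gpos in auto)
qed

section \<open>Walks that stay above their start, and their blocks\<close>

definition above_saws :: "('a \<Rightarrow> real) \<Rightarrow> 'a \<Rightarrow> nat \<Rightarrow> 'a list set" where
  "above_saws h v n = {p \<in> saw v n. \<forall>x\<in>set p. h v \<le> h x}"

text \<open>
  A block ends strictly above all its previous vertices and stays above its start, so blocks can be
  concatenated without losing self-avoidance.
\<close>

definition block :: "('a \<Rightarrow> real) \<Rightarrow> 'a set \<Rightarrow> 'a \<Rightarrow> 'a list \<Rightarrow> bool" where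
  "block h S s xs \<longleftrightarrow> xs \<noteq> [] \<and> length xs \<le> 4 \<and> distinct (s # xs) \<and>
     successively (\<lambda>u v. {u, v} \<in> E) (s # xs) \<and> last xs \<in> S \<and>
     (\<forall>x\<in>set (s # butlast xs). h s \<le> h x \<and> h x < h (last xs))"

lemma successively_in_V: "successively (\<lambda>u v. {u, v} \<in> E) (s # xs) \<Longrightarrow> set xs \<subseteq> V"
  by (induction xs arbitrary: s) (auto simp: successively_Cons dest: edgeD)

text \<open>The last vertex of the block is the first vertex of \<open>q\<close>, hence
  \<open>butlast\<close>; the vertices before it lie strictly below all of \<open>q\<close>.\<close>

lemma block_append:
  assumes b: "block h S s xs" and s: "s \<in> V" and q: "q \<in> above_saws h (last xs) k"
  shows "s # butlast xs @ q \<in> above_saws h s (length xs + k)"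
proof -
  obtain ys t where xs: "xs = ys @ [t]" using b by (metis block_def rev_exhaust)
  have b': "distinct (s # ys @ [t])" "successively (\<lambda>u v. {u, v} \<in> E) (s # ys @ [t])"
    "\<And>x. x \<in> set (s # ys) \<Longrightarrow> h s \<le> h x \<and> h x < h t"
    using b by (auto simp: block_def xs)
  have q': "length q = Suc k" "hd q = t" "set q \<subseteq> V" "distinct q" "successively (\<lambda>u v. {u, v} \<in> E) q"
    "\<And>x. x \<in> set q \<Longrightarrow> h t \<le> h x"
    using q by (auto simp: above_saws_def saws_def xs)
  have "q \<noteq> []" using q'(1) by auto
  then have succ: "successively (\<lambda>u v. {u, v} \<in> E) (s # ys @ q)"
    by (rule successively_butlast_append[OF b'(2) q'(5) q'(2)])
  have disj: "x \<notin> set q" if "x \<in> set (s # ys)" for x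
    using b'(3)[OF that] q'(6)[of x] by auto
  have "h s < h t" using b'(3)[of s] by simp
  then have "h s \<le> h x" if "x \<in> set q" for x using q'(6)[OF that] by linarith
  moreover have "set (s # ys @ q) \<subseteq> V" using successively_in_V[OF succ] s by auto
  ultimately show ?thesis
    using succ disj b' q' unfolding above_saws_def saws_def xs by auto
qed

lemma finite_above_saws: "v \<in> V \<Longrightarrow> finite (above_saws h v n)"
  using finite_saws by (simp add: above_saws_def)

text \<open>Supplies walks whose length is not a sum of block lengths: the last block is cut short.
  What remains still stays above \<open>s\<close>, and \<open>above_saws\<close> asks for no
  more.\<close>

lemma block_take:
  assumes b: "block h S s xs" and s: "s \<in> V" and n: "n < length xs"
  shows "take (Suc n) (s # xs) \<in> above_saws h s n"
proof -
  have "successively (\<lambda>u v. {u, v} \<in> E) (take (Suc n) (s # xs))"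
    using b by (metis (mono_tags, lifting) append_take_drop_id block_def successively_append_iff)
  moreover have "distinct (take (Suc n) (s # xs))" using b by (intro distinct_take) (simp add: block_def)
  moreover have "set (s # xs) \<subseteq> V" using b successively_in_V[of s xs] s by (simp add: block_def)
  then have "set (take (Suc n) (s # xs)) \<subseteq> V" using set_take_subset by fastforce
  moreover have "h s \<le> h x" if "x \<in> set (s # xs)" for x
  proof -
    have "set xs = insert (last xs) (set (butlast xs))"
      using b by (metis append_butlast_last_id block_def insert_is_Un list.set(1) list.set(2) set_append sup_commute)
    with that b show ?thesis by (auto simp: block_def less_imp_le)
  qed
  then have "\<forall>x\<in>set (take (Suc n) (s # xs)). h s \<le> h x" by (meson in_set_takeD)
  ultimately show ?thesis using n by (simp add: above_saws_def saws_def)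
qed

text \<open>Splitting off the first block bounds the count at \<open>n\<close> from below by the sum
  of the counts at \<open>n - length xs\<close>, and by the weight condition phi^n satisfies the
  opposite inequality. Prefix-freeness makes the splitting unique, so different pairs of block and
  remainder give different walks.\<close>

lemma block_growth:
  assumes S: "S \<subseteq> V" "S \<noteq> {}"
    and blk: "\<And>s xs. s \<in> S \<Longrightarrow> xs \<in> B s \<Longrightarrow> block h S s xs"
    and pf: "\<And>s xs ys. s \<in> S \<Longrightarrow> xs \<in> B s \<Longrightarrow> ys \<in> B s \<Longrightarrow> prefix xs ys \<Longrightarrow> xs = ys"
    and fin: "\<And>s. s \<in> S \<Longrightarrow> finite (B s)"
    and wt: "\<And>s. s \<in> S \<Longrightarrow> 1 \<le> (\<Sum>xs\<in>B s. 1 / golden ^ length xs)"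
  shows golden_growth
proof -
  have gpos: "1 < golden" using golden_bounds by linarith
  have nonempty: "above_saws h s n \<noteq> {}" if "s \<in> S" for s n
    using that
  proof (induction n arbitrary: s rule: less_induct)
    case (less n)
    obtain xs where xs: "xs \<in> B s" using wt[OF less.prems] by force
    note b = blk[OF less.prems xs]
    have sV: "s \<in> V" using S less.prems by auto
    show ?case
    proof (cases "n < length xs")
      case True
      then show ?thesis using block_take[OF b sV] by blast
    next
      case False
      have "length xs > 0" "last xs \<in> S" using b by (auto simp: block_def)
      moreover from this False have "n - length xs < n" by linarith
      ultimately have "above_saws h (last xs) (n - length xs) \<noteq> {}"
        using less.IH by blast
      then obtain q where "q \<in> above_saws h (last xs) (n - length xs)" by blast
      from block_append[OF b sV this] False show ?thesis by auto
    qed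
  qed
  have main: "golden ^ n / golden ^ 4 \<le> real (card (above_saws h s n))" if "s \<in> S" for s n
    using that
  proof (induction n arbitrary: s rule: less_induct)
    case (less n)
    have sV: "s \<in> V" using S less.prems by auto
    show ?case
    proof (cases "n < 4")
      case True
      then have "golden ^ n \<le> golden ^ 4" using gpos by (intro power_increasing) auto
      then have "golden ^ n / golden ^ 4 \<le> 1" using gpos by (simp add: divide_le_eq)
      moreover have "card (above_saws h s n) > 0"
        using nonempty less.prems finite_above_saws sV by (simp add: card_gt_0_iff)
      ultimately show ?thesis by linarith
    next
      case False
      note b = blk[OF less.prems]
      let ?W = "\<lambda>xs. above_saws h (last xs) (n - length xs)"
      let ?f = "\<lambda>(xs, q). s # butlast xs @ q"
      have len: "0 < length xs" "length xs \<le> 4" "last xs \<in> S" if "xs \<in> B s" for xs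
        using b[OF that] by (auto simp: block_def)
      have hdq: "q = last xs # tl q" if "q \<in> ?W xs" for q xs
        using that by (cases q) (auto simp: above_saws_def saws_def)
      have "inj_on ?f (Sigma (B s) ?W)"
      proof (rule inj_onI, clarsimp)
        fix xs q xs' q'
        assume x: "xs \<in> B s" "q \<in> ?W xs" "xs' \<in> B s" "q' \<in> ?W xs'"
          and eq: "butlast xs @ q = butlast xs' @ q'"
        \<comment> \<open>Moves the shared vertex back to the block, so that the whole block is a
          prefix of the walk and prefix-freeness applies.\<close>
        have split: "butlast xs @ q = xs @ tl q" if "xs \<in> B s" "q \<in> ?W xs" for xs q
        proof -
          have "butlast xs @ q = butlast xs @ [last xs] @ tl q" using hdq[OF that(2)] by simp
          then show ?thesis using len(1)[OF that(1)] by (metis append.assoc append_butlast_last_id length_greater_0_conv)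
        qed
        have eq': "xs @ tl q = xs' @ tl q'" using eq split x by simp
        then have "prefix xs xs' \<or> prefix xs' xs"
          by (metis prefixI prefix_same_cases)
        then have "xs = xs'" using pf[OF less.prems] x by blast
        with eq show "xs = xs' \<and> q = q'" by simp
      qed
      moreover have "?f ` Sigma (B s) ?W \<subseteq> above_saws h s n"
      proof clarify
        fix xs q assume "xs \<in> B s" "q \<in> ?W xs"
        then show "s # butlast xs @ q \<in> above_saws h s n"
          using block_append[OF b sV, of xs q "n - length xs"] len[of xs] False by simp
      qed
      ultimately have "card (Sigma (B s) ?W) \<le> card (above_saws h s n)"
        using finite_above_saws[OF sV] by (rule card_inj_on_le)
      moreover have "card (Sigma (B s) ?W) = (\<Sum>xs\<in>B s. card (?W xs))"
        using fin[OF less.prems] len(3) finite_above_saws S by (intro card_SigmaI ballI) blast+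
      moreover have "golden ^ n / golden ^ 4 * (\<Sum>xs\<in>B s. 1 / golden ^ length xs)
          \<le> (\<Sum>xs\<in>B s. real (card (?W xs)))"
        unfolding sum_distrib_left
      proof (rule sum_mono)
        fix xs assume xs: "xs \<in> B s"
        have "golden ^ n = golden ^ (n - length xs) * golden ^ length xs"
          using len(2)[OF xs] False by (simp flip: power_add)
        then have "golden ^ n / golden ^ 4 * (1 / golden ^ length xs) = golden ^ (n - length xs) / golden ^ 4"
          using gpos by simp
        also have "\<dots> \<le> real (card (?W xs))"
          using less.IH len[OF xs] False by simp
        finally show "golden ^ n / golden ^ 4 * (1 / golden ^ length xs) \<le> real (card (?W xs))" .
      qed
      moreover have "golden ^ n / golden ^ 4 * 1 \<le> golden ^ n / golden ^ 4 * (\<Sum>xs\<in>B s. 1 / golden ^ length xs)"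
        using gpos wt[OF less.prems] by (intro mult_left_mono) auto
      moreover have "(\<Sum>xs\<in>B s. real (card (?W xs))) \<le> real (card (above_saws h s n))"
        using calculation(1,2) by (simp flip: of_nat_sum)
      ultimately show ?thesis by linarith
    qed
  qed
  obtain s where s: "s \<in> S" using S by blast
  have "golden ^ n / golden ^ 4 \<le> real (card (saw s n))" for n
  proof -
    have "card (above_saws h s n) \<le> card (saw s n)"
      using s S finite_saws by (intro card_mono) (auto simp: above_saws_def)
    with main[OF s, of n] show ?thesis by linarith
  qed
  then show ?thesis unfolding golden_growth_def using s S by blast
qed

end

lemma two_way_path_edge_iff: "{i, j} \<in> two_way_path_edges \<longleftrightarrow> j = i + 1 \<or> i = j + 1"
  by (auto simp: two_way_path_edges_def doubleton_eq_iff)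

section \<open>Blocks for each local shape, and recognition of the two-way infinite path\<close>

context transitive_graph
begin

lemma block_family_growth:
  assumes S: "S \<subseteq> V" "S \<noteq> {}"
    and ex: "\<And>s. s \<in> S \<Longrightarrow> \<exists>B. finite B \<and> (\<forall>xs\<in>B. block h S s xs) \<and>
        (\<forall>xs\<in>B. \<forall>ys\<in>B. prefix xs ys \<longrightarrow> xs = ys) \<and> 1 \<le> (\<Sum>xs\<in>B. 1 / golden ^ length xs)"
  shows golden_growth
proof -
  obtain B where "\<forall>s\<in>S. finite (B s) \<and> (\<forall>xs\<in>B s. block h S s xs) \<and>
        (\<forall>xs\<in>B s. \<forall>ys\<in>B s. prefix xs ys \<longrightarrow> xs = ys) \<and> 1 \<le> (\<Sum>xs\<in>B s. 1 / golden ^ length xs)"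
    using ex by metis
  then show ?thesis by (intro block_growth[OF S, of B h]) blast+
qed

lemma growth_two_up:
  fixes k :: "'a \<Rightarrow> real"
  assumes two: "\<And>v. v \<in> V \<Longrightarrow> \<exists>x\<in>nb v. \<exists>y\<in>nb v. x \<noteq> y \<and> k v < k x \<and> k v < k y"
  shows golden_growth
proof (rule block_family_growth[of V])
  fix s assume "s \<in> V"
  then obtain x y where xy: "{s, x} \<in> E" "{s, y} \<in> E" "x \<noteq> y" "k s < k x" "k s < k y"
    using two by blast
  have "block k V s [x]" "block k V s [y]"
    using xy edgeD by (auto simp: block_def)
  moreover have "1 \<le> (\<Sum>xs\<in>{[x], [y]}. 1 / golden ^ length xs)"
    using xy golden_bounds by (simp add: field_simps)
  ultimately show "\<exists>B. finite B \<and> (\<forall>xs\<in>B. block k V s xs) \<and>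
        (\<forall>xs\<in>B. \<forall>ys\<in>B. prefix xs ys \<longrightarrow> xs = ys) \<and> 1 \<le> (\<Sum>xs\<in>B. 1 / golden ^ length xs)"
    using xy by (intro exI[of _ "{[x], [y]}"]) auto
qed (use V_nonempty in auto)

text \<open>\<open>z\<close> may coincide with \<open>x\<close>: the two blocks already differ in
  their first vertex, as \<open>k x\<close> exceeds \<open>k y\<close>, so neither is a prefix of
  the other.\<close>

lemma growth_level:
  fixes k :: "'a \<Rightarrow> real"
  assumes up: "\<And>v. v \<in> V \<Longrightarrow> \<exists>x\<in>nb v. k v < k x"
    and level: "\<And>v. v \<in> V \<Longrightarrow> \<exists>x\<in>nb v. k x = k v"
  shows golden_growth
proof (rule block_family_growth[of V])
  fix s assume "s \<in> V"
  then obtain x y where xy: "{s, x} \<in> E" "{s, y} \<in> E" "k s < k x" "k y = k s"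
    using up level by blast
  then obtain z where z: "{y, z} \<in> E" "k y < k z" using up edgeD by blast
  have "block k V s [x]" "block k V s [y, z]"
    using xy z edgeD[of s x] edgeD[of s y] edgeD[of y z] by (auto simp: block_def)
  moreover have "1 \<le> (\<Sum>xs\<in>{[x], [y, z]}. 1 / golden ^ length xs)"
    using xy golden_bounds golden_square by (simp add: field_simps power2_eq_square)
  ultimately show "\<exists>B. finite B \<and> (\<forall>xs\<in>B. block k V s xs) \<and>
        (\<forall>xs\<in>B. \<forall>ys\<in>B. prefix xs ys \<longrightarrow> xs = ys) \<and> 1 \<le> (\<Sum>xs\<in>B. 1 / golden ^ length xs)"
    using xy by (intro exI[of _ "{[x], [y, z]}"]) auto
qed (use V_nonempty in auto)

text \<open>Branching is assumed only in \<open>S\<close>, so a block takes a second step to return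
  there. Three branches suffice because phi^2 < 3; two would not.\<close>

lemma growth_three:
  fixes k :: "'a \<Rightarrow> real"
  assumes S: "S \<subseteq> V" "S \<noteq> {}"
    and three: "\<And>s. s \<in> S \<Longrightarrow> 3 \<le> card {x \<in> nb s. k s < k x}"
    and return: "\<And>s x. s \<in> S \<Longrightarrow> x \<in> nb s \<Longrightarrow> k s < k x \<Longrightarrow> \<exists>y\<in>nb x. y \<in> S \<and> k x < k y"
  shows golden_growth
proof (rule block_family_growth[OF S])
  fix s assume s: "s \<in> S"
  define X where "X = {x \<in> nb s. k s < k x}"
  have fin: "finite X" unfolding X_def using finite_nb[of s] by simp
  obtain u where u: "\<And>x. x \<in> X \<Longrightarrow> {x, u x} \<in> E \<and> u x \<in> S \<and> k x < k (u x)"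
    using return[OF s] unfolding X_def by (metis (mono_tags, lifting) mem_Collect_eq)
  define B where "B = (\<lambda>x. [x, u x]) ` X"
  have "inj_on (\<lambda>x. [x, u x]) X" by (auto intro: inj_onI)
  then have "(\<Sum>xs\<in>B. 1 / golden ^ length xs) = real (card X) / golden\<^sup>2"
    unfolding B_def by (subst sum.reindex) (simp_all add: power2_eq_square)
  moreover have "3 \<le> real (card X)" using three[OF s] unfolding X_def by simp
  ultimately have "1 \<le> (\<Sum>xs\<in>B. 1 / golden ^ length xs)"
    using golden_bounds by (simp add: golden_square)
  moreover have "block k S s xs" if xs: "xs \<in> B" for xs
  proof -
    obtain x where x: "x \<in> X" "xs = [x, u x]" using xs unfolding B_def by blast
    have "{s, x} \<in> E" "k s < k x" using x by (auto simp: X_def)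
    with u[OF x(1)] show ?thesis
      unfolding x(2) using edgeD[of s x] edgeD[of x "u x"] by (auto simp: block_def)
  qed
  ultimately show "\<exists>B. finite B \<and> (\<forall>xs\<in>B. block k S s xs) \<and>
        (\<forall>xs\<in>B. \<forall>ys\<in>B. prefix xs ys \<longrightarrow> xs = ys) \<and> 1 \<le> (\<Sum>xs\<in>B. 1 / golden ^ length xs)"
    using fin by (intro exI[of _ B]) (auto simp: B_def)
qed

text \<open>Two blocks of length 2 weigh only 2/phi^2 < 1. The missing weight comes from blocks of
  length 4, which in the application go up, down, up, up; \<open>x' \<noteq> z\<close> keeps the
  blocks through \<open>x\<close> prefix-free.\<close>

lemma growth_zigzag:
  fixes k :: "'a \<Rightarrow> real"
  assumes S: "S \<subseteq> V" "S \<noteq> {}"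
    and two: "\<And>s. s \<in> S \<Longrightarrow> \<exists>x\<in>nb s. \<exists>y\<in>nb s. x \<noteq> y \<and> k s < k x \<and> k s < k y"
    and zigzag: "\<And>s x. s \<in> S \<Longrightarrow> x \<in> nb s \<Longrightarrow> k s < k x \<Longrightarrow>
      \<exists>x' z w w'. block k S s [x, x'] \<and> block k S s [x, z, w, w'] \<and> x' \<noteq> z"
  shows golden_growth
proof (rule block_family_growth[OF S])
  fix s assume s: "s \<in> S"
  obtain x y where xy: "x \<in> nb s" "y \<in> nb s" "x \<noteq> y" "k s < k x" "k s < k y"
    using two[OF s] by blast
  obtain x' z w w' where 1: "block k S s [x, x']" "block k S s [x, z, w, w']" "x' \<noteq> z"
    using zigzag[OF s xy(1,4)] by blast
  obtain y' a b b' where 2: "block k S s [y, y']" "block k S s [y, a, b, b']" "y' \<noteq> a"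
    using zigzag[OF s xy(2,5)] by blast
  let ?B = "{[x, x'], [x, z, w, w'], [y, y'], [y, a, b, b']}"
  \<comment> \<open>With phi < 13/8, phi^2 = phi + 1 is below 21/8 and phi^4 = 3 phi + 2 is below
    55/8; and 16/21 + 16/55 > 1.\<close>
  have "2 / (21 / 8) \<le> 2 / golden\<^sup>2" "2 / (55 / 8) \<le> 2 / golden ^ 4"
    using golden_bounds by (intro frac_le; simp add: golden_square golden_power4)+
  then have "1 \<le> 2 / golden\<^sup>2 + 2 / golden ^ 4" by simp
  also have "\<dots> = (\<Sum>xs\<in>?B. 1 / golden ^ length xs)"
    using xy by (simp add: power2_eq_square power4_eq_xxxx mult.assoc)
  finally have wt: "1 \<le> (\<Sum>xs\<in>?B. 1 / golden ^ length xs)" .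
  show "\<exists>B. finite B \<and> (\<forall>xs\<in>B. block k S s xs) \<and>
        (\<forall>xs\<in>B. \<forall>ys\<in>B. prefix xs ys \<longrightarrow> xs = ys) \<and> 1 \<le> (\<Sum>xs\<in>B. 1 / golden ^ length xs)"
    using xy 1 2 wt by (intro exI[of _ ?B]) auto
qed

text \<open>The maps \<open>s\<close> to the upper and \<open>p\<close> to the lower neighbour are
  mutually inverse: the upper neighbour of \<open>s v\<close> is higher than \<open>s v\<close>, so
  \<open>v\<close> must be the lower one. Iterating them from one vertex gives a map from the
  integers, injective by heights and onto by connectedness.\<close>

lemma isomorphic_two_way_path:
  fixes k :: "'a \<Rightarrow> real"
  assumes nb2: "\<And>v. v \<in> V \<Longrightarrow> \<exists>x y. nb v = {x, y} \<and> k v < k x \<and> k y < k v"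
  shows "isomorphic_graphs V E (UNIV :: int set) two_way_path_edges"
proof -
  obtain s p where sp: "\<And>v. v \<in> V \<Longrightarrow> nb v = {s v, p v} \<and> k v < k (s v) \<and> k (p v) < k v"
    using nb2 by metis
  have sE: "{v, s v} \<in> E" and pE: "{v, p v} \<in> E" if "v \<in> V" for v
    using sp[OF that] by auto
  have sV: "s v \<in> V" and pV: "p v \<in> V" if "v \<in> V" for v
    using sE pE edgeD that by blast+
  have ps: "p (s v) = v" if v: "v \<in> V" for v
  proof -
    have "v \<in> nb (s v)" using sE[OF v] edge_sym by simp
    then have "v \<in> {s (s v), p (s v)}" using sp[OF sV[OF v]] by simp
    moreover have "k v < k (s (s v))" using sp[OF v] sp[OF sV[OF v]] by linarith
    ultimately show ?thesis by auto
  qed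
  have sp': "s (p v) = v" if v: "v \<in> V" for v
  proof -
    have "v \<in> nb (p v)" using pE[OF v] edge_sym by simp
    then have "v \<in> {s (p v), p (p v)}" using sp[OF pV[OF v]] by simp
    moreover have "k (p (p v)) < k v" using sp[OF v] sp[OF pV[OF v]] by linarith
    ultimately show ?thesis by auto
  qed
  obtain c where c: "c \<in> V" using V_nonempty by blast
  define f :: "int \<Rightarrow> 'a" where
    "f i = (if 0 \<le> i then (s ^^ nat i) c else (p ^^ nat (- i)) c)" for i
  have sn: "(s ^^ n) c \<in> V" and pn: "(p ^^ n) c \<in> V" for n
    by (induction n) (auto simp: c sV pV)
  have fV: "f i \<in> V" for i by (simp add: f_def sn pn)
  have f_Suc: "f (i + 1) = s (f i)" for i
  proof (cases "0 \<le> i")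
    case True
    then have "nat (i + 1) = Suc (nat i)" by simp
    with True show ?thesis by (simp add: f_def)
  next
    case False
    \<comment> \<open>Below zero, \<open>f i\<close> is one \<open>p\<close> beyond
      \<open>f (i + 1)\<close>. For \<open>m = 0\<close> the index \<open>i + 1\<close> is 0 and
      falls under the other branch of \<open>f\<close>.\<close>
    define m where "m = nat (- i - 1)"
    have i: "i = - int m - 1" using False by (simp add: m_def)
    have "f i = p ((p ^^ m) c)" unfolding f_def i by (simp add: nat_add_distrib)
    moreover have "f (i + 1) = (p ^^ m) c" unfolding f_def i by (cases "m = 0") auto
    ultimately show ?thesis using sp'[OF pn] by simp
  qed
  have f_pred: "f (i - 1) = p (f i)" for i
    using f_Suc[of "i - 1"] ps[OF fV] by simp
  have mono: "k (f i) < k (f (i + 1 + int n))" for i n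
  proof (induction n)
    case 0
    show ?case using f_Suc sp[OF fV] by simp
  next
    case (Suc n)
    have "k (f (i + 1 + int n)) < k (f (i + 1 + int n + 1))"
        using f_Suc[of "i + 1 + int n"] sp[OF fV[of "i + 1 + int n"]] by (simp only:)
    with Suc show ?case by (simp add: algebra_simps)
  qed
  have less: "k (f i) < k (f j)" if "i < j" for i j
  proof -
    have "j = i + 1 + int (nat (j - i - 1))" using that by simp
    with mono[of i "nat (j - i - 1)"] show ?thesis by simp
  qed
  have inj: "inj f"
    by (rule injI) (metis less less_irrefl linorder_neqE)
  have "v \<in> range f" if "v \<in> V" for v
    using c that
  proof (induction rule: connected_induct)
    case base
    have "f 0 = c" by (simp add: f_def)
    then show ?case by blast
  next
    case (step x y)
    then obtain i where i: "x = f i" by blast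
    have "y \<in> {s (f i), p (f i)}" using sp[OF fV[of i]] step(1) i by auto
    then show ?case using f_Suc[of i] f_pred[of i] by (metis empty_iff insert_iff range_eqI)
  qed
  then have range: "range f = V" using fV by blast
  have edge: "{f i, f j} \<in> E \<longleftrightarrow> {i, j} \<in> two_way_path_edges" for i j
  proof -
    have "{f i, f j} \<in> E \<longleftrightarrow> f j \<in> {f (i + 1), f (i - 1)}"
      using sp[OF fV[of i]] f_Suc[of i] f_pred[of i] by auto
    also have "\<dots> \<longleftrightarrow> j = i + 1 \<or> j = i - 1" using inj by (simp add: inj_eq)
    finally show ?thesis by (auto simp: two_way_path_edge_iff)
  qed
  have "bij_betw f UNIV V" using inj range by (simp add: bij_betw_def)
  then have "bij_betw (inv f) V UNIV" using bij_betw_inv_into by blast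
  moreover have "{u, v} \<in> E \<longleftrightarrow> {inv f u, inv f v} \<in> two_way_path_edges" if "u \<in> V" "v \<in> V" for u v
    using edge[of "inv f u" "inv f v"] that range by (simp add: f_inv_into_f)
  ultimately show ?thesis unfolding isomorphic_graphs_def graph_iso_def by blast
qed

end

section \<open>Cuts of two-ended graphs\<close>

text \<open>Koenig's lemma: if infinitely many points are reachable from \<open>x\<close>, the same
  holds for one of its finitely many successors, so the choice never gets stuck.\<close>

lemma koenig_sequence:
  assumes fb: "\<And>x. finite (R `` {x})" and S: "finite S" and inf: "infinite (R\<^sup>* `` S)"
  obtains f :: "nat \<Rightarrow> 'b" where "f 0 \<in> S" "\<And>i. (f i, f (Suc i)) \<in> R"
proof -
  let ?P = "\<lambda>x. infinite (R\<^sup>* `` {x})"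
  have "R\<^sup>* `` S = (\<Union>x\<in>S. R\<^sup>* `` {x})" by blast
  then obtain x0 where x0: "x0 \<in> S" "?P x0" using S inf by auto
  have step: "\<exists>y. (x, y) \<in> R \<and> ?P y" if x: "?P x" for x
  proof (rule ccontr)
    assume "\<not> ?thesis"
    then have "finite (insert x (\<Union>y\<in>R `` {x}. R\<^sup>* `` {y}))" using fb by blast
    moreover have "R\<^sup>* `` {x} \<subseteq> insert x (\<Union>y\<in>R `` {x}. R\<^sup>* `` {y})"
      by (auto elim: converse_rtranclE)
    ultimately show False using x finite_subset by blast
  qed
  have "\<exists>f. \<forall>n. (?P (f n) \<and> (n = 0 \<longrightarrow> f n \<in> S)) \<and> (f n, f (Suc n)) \<in> R"
    by (rule dependent_nat_choice) (use x0 step in auto)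
  then show ?thesis using that by blast
qed

abbreviation almost_equal :: "'b set \<Rightarrow> 'b set \<Rightarrow> bool" where
  "almost_equal A B \<equiv> finite (A - B) \<and> finite (B - A)"

abbreviation eventually_in :: "(nat \<Rightarrow> 'b) \<Rightarrow> 'b set \<Rightarrow> bool" where
  "eventually_in r A \<equiv> \<exists>N. \<forall>i\<ge>N. r i \<in> A"

lemma eventually_in_disjoint: "eventually_in r A \<Longrightarrow> eventually_in r B \<Longrightarrow> A \<inter> B \<noteq> {}"
  by (metis IntI empty_iff linorder_le_cases)

lemma eventually_in_infinite:
  assumes "inj r" "eventually_in r A" shows "infinite A"
proof
  assume "finite A"
  obtain N where "\<forall>i\<ge>N. r i \<in> A" using assms(2) by blast
  then have "r ` {N..} \<subseteq> A" by auto
  then have "finite (r ` {N..})" using \<open>finite A\<close> finite_subset by blast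
  then show False using assms(1) by (metis finite_imageD infinite_Ici inj_on_subset subset_UNIV)
qed

section \<open>Edge boundaries and the ends they separate\<close>

context transitive_graph
begin

definition cob :: "'a set \<Rightarrow> 'a set set" where
  "cob A = {e \<in> E. e \<inter> A \<noteq> {} \<and> e \<inter> (V - A) \<noteq> {}}"

text \<open>One side of a finite cut with two infinite sides; in a two-ended graph each side holds
  exactly one end.\<close>

definition half :: "'a set \<Rightarrow> bool" where
  "half A \<longleftrightarrow> A \<subseteq> V \<and> finite (cob A) \<and> infinite A \<and> infinite (V - A)"

lemma edge_cob: "{u, v} \<in> E \<Longrightarrow> {u, v} \<in> cob A \<longleftrightarrow> (u \<in> A \<longleftrightarrow> v \<notin> A)"
  using edgeD[of u v] by (auto simp: cob_def)

lemma cob_subset: "cob A \<subseteq> E"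
  by (auto simp: cob_def)

lemma cob_compl: "A \<subseteq> V \<Longrightarrow> cob (V - A) = cob A"
  by (auto simp: cob_def)

lemma cobE:
  assumes "e \<in> cob A"
  obtains u v where "e = {u, v}" "{u, v} \<in> E" "u \<in> V" "v \<in> V" "u \<in> A" "v \<notin> A"
proof -
  have "e \<in> E" using assms cob_subset by blast
  then obtain u v where uv: "e = {u, v}" "u \<in> V" "v \<in> V" by (rule edgeE)
  then have "u \<in> A \<longleftrightarrow> v \<notin> A" using assms \<open>e \<in> E\<close> edge_cob by metis
  then show ?thesis using that[of u v] that[of v u] uv \<open>e \<in> E\<close> by (metis insert_commute)
qed

lemma cob_diff: "cob (A - B) \<subseteq> cob A \<union> cob B"
proof
  fix e assume "e \<in> cob (A - B)"
  then obtain u v where "e = {u, v}" "{u, v} \<in> E" "u \<in> A - B" "v \<notin> A - B" by (rule cobE)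
  then show "e \<in> cob A \<union> cob B" using edge_cob[of u v A] edge_cob[of u v B] by auto
qed

lemma finite_Union_cob: "finite (cob A) \<Longrightarrow> finite (\<Union>(cob A))"
  by (auto elim: cobE)

lemma half_compl: "half A \<Longrightarrow> half (V - A)"
  by (auto simp: half_def cob_compl double_diff)

lemma joined_same_side: "joined (E - cob A) u v \<Longrightarrow> u \<in> A \<longleftrightarrow> v \<in> A"
  unfolding joined_def
proof (induction rule: rtrancl_induct)
  case (step y z)
  then show ?case using edge_cob[of y z A] by (auto simp: adj_rel_def)
qed simp

lemma cob_empty: assumes "cob A = {}" "A \<subseteq> V" shows "A = {} \<or> A = V"
proof (rule ccontr)
  assume "\<not> ?thesis"
  then obtain u v where uv: "u \<in> V" "v \<in> V" "u \<in> A" "v \<notin> A" using assms(2) by blast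
  from uv(1,2) have "v \<in> A"
  proof (induction rule: connected_induct)
    case (step x y)
    then show ?case using edge_cob[of x y A] assms(1) by auto
  qed (rule uv(3))
  with uv show False by simp
qed

lemma ray_side:
  assumes r: "r \<in> rays V E" and A: "finite (cob A)"
  shows "eventually_in r A \<or> eventually_in r (V - A)"
proof -
  obtain N where N: "\<And>i j. i \<ge> N \<Longrightarrow> j \<ge> N \<Longrightarrow> joined (E - cob A) (r i) (r j)"
    using ray_tail_joined[OF r A] by metis
  then have "r i \<in> A \<longleftrightarrow> r N \<in> A" if "i \<ge> N" for i
    using joined_same_side[of A "r i" "r N"] that by simp
  moreover have "r i \<in> V" for i using r by (auto simp: rays_def)
  ultimately show ?thesis by (cases "r N \<in> A") blast+
qed

lemma ray_equiv_side:
  assumes rs: "(r, s) \<in> ray_equiv V E" and A: "finite (cob A)" and r: "eventually_in r A"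
  shows "eventually_in s A"
proof (rule ccontr)
  assume "\<not> ?thesis"
  moreover have "s \<in> rays V E" using rs by (simp add: ray_equiv_def)
  ultimately have "eventually_in s (V - A)" using ray_side A by blast
  with r obtain N M where NM: "\<forall>i\<ge>N. r i \<in> A" "\<forall>i\<ge>M. s i \<in> V - A" by blast
  have "\<not> joined (E - cob A) (r i) (s j)" if "i \<ge> max N M" "j \<ge> max N M" for i j
  proof
    assume "joined (E - cob A) (r i) (s j)"
    from joined_same_side[OF this] NM that show False by auto
  qed
  then have "separates E (cob A) r s" unfolding separates_def by blast
  with rs A cob_subset show False by (auto simp: ray_equiv_def)
qed

text \<open>All of \<open>A\<close> is reachable inside \<open>A\<close> from the finite set
  \<open>S\<close>: a path from \<open>a\<close> that leaves \<open>A\<close> comes back through an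
  endpoint of a boundary edge. Koenig's lemma is applied to steps that increase the distance from
  \<open>S\<close>, so the sequence repeats no vertex and is a ray.\<close>

lemma ray_in_infinite:
  assumes A: "A \<subseteq> V" "infinite A" "finite (cob A)"
  obtains r where "r \<in> rays V E" "range r \<subseteq> A"
proof -
  obtain a where a: "a \<in> A" using A(2) by fastforce
  define S where "S = A \<inter> insert a (\<Union>(cob A))"
  define T where "T = {(x, y). {x, y} \<in> E \<and> x \<in> A \<and> y \<in> A}"
  have finS: "finite S" unfolding S_def using finite_Union_cob[OF A(3)] by simp
  have reach: "\<exists>n. \<exists>x\<in>S. (x, y) \<in> T ^^ n" if y: "y \<in> A" for y
  proof -
    have "y \<in> A \<longrightarrow> y \<in> T\<^sup>* `` S"
    proof (rule connected_induct[of a y])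
      show "a \<in> A \<longrightarrow> a \<in> T\<^sup>* `` S" using a by (auto simp: S_def)
      fix x y assume xy: "{x, y} \<in> E" and IH: "x \<in> A \<longrightarrow> x \<in> T\<^sup>* `` S"
      show "y \<in> A \<longrightarrow> y \<in> T\<^sup>* `` S"
      proof
        assume y: "y \<in> A"
        show "y \<in> T\<^sup>* `` S"
        proof (cases "x \<in> A")
          case True
          then have "(x, y) \<in> T" using xy y by (simp add: T_def)
          moreover obtain z where "z \<in> S" "(z, x) \<in> T\<^sup>*" using IH True by blast
          ultimately show ?thesis by (meson ImageI rtrancl.rtrancl_into_rtrancl)
        next
          case False
          then have "{x, y} \<in> cob A" using edge_cob[OF xy] y by simp
          then have "y \<in> S" using y by (auto simp: S_def)
          then show ?thesis by blast
        qed
      qed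
    qed (use a y A in auto)
    then show ?thesis using y rtrancl_imp_relpow by blast
  qed
  define d where "d y = (LEAST n. \<exists>x\<in>S. (x, y) \<in> T ^^ n)" for y
  have d_le: "d y \<le> n" if "x \<in> S" "(x, y) \<in> T ^^ n" for x y n
    unfolding d_def using that by (intro Least_le) blast
  have d_ex: "\<exists>x\<in>S. (x, y) \<in> T ^^ d y" if "y \<in> A" for y
    unfolding d_def using reach[OF that] by (rule LeastI_ex)
  define R where "R = {(x, y) \<in> T. d y = Suc (d x)}"
  have "y \<in> R\<^sup>* `` S" if "y \<in> A" "d y = n" for y n
    using that
  proof (induction n arbitrary: y)
    case 0
    then show ?case using d_ex[of y] by auto
  next
    case (Suc n)
    obtain x where x: "x \<in> S" "(x, y) \<in> T ^^ Suc n" using d_ex[of y] Suc.prems by auto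
    then obtain z where z: "(x, z) \<in> T ^^ n" "(z, y) \<in> T" by auto
    have zA: "z \<in> A" using z by (simp add: T_def)
    obtain x' where x': "x' \<in> S" "(x', z) \<in> T ^^ d z" using d_ex[OF zA] by blast
    have "d y \<le> Suc (d z)" using d_le[OF x'(1) relpow_Suc_I[OF x'(2) z(2)]] .
    moreover have "d z \<le> n" using d_le[OF x(1) z(1)] .
    ultimately have dz: "d z = n" using Suc.prems by simp
    then have "(z, y) \<in> R" using z Suc.prems by (simp add: R_def)
    moreover have "z \<in> R\<^sup>* `` S" using Suc.IH[OF zA dz] .
    ultimately show ?case by (meson Image_iff rtrancl.rtrancl_into_rtrancl)
  qed
  then have "A \<subseteq> R\<^sup>* `` S" by blast
  then have inf: "infinite (R\<^sup>* `` S)" using A(2) finite_subset by blast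
  have fb: "finite (R `` {x})" for x
    by (rule finite_subset[OF _ finite_nb[of x]]) (auto simp: R_def T_def)
  obtain f where f: "f 0 \<in> S" "\<And>i. (f i, f (Suc i)) \<in> R"
    using koenig_sequence[OF fb finS inf] by metis
  have df: "d (f i) = d (f 0) + i" for i
    by (induction i) (use f(2) in \<open>auto simp: R_def\<close>)
  have "inj f" by (rule injI) (metis df add_left_cancel)
  moreover have "f i \<in> A" "{f i, f (Suc i)} \<in> E" for i using f(2)[of i] by (auto simp: R_def T_def)
  ultimately show ?thesis using that[of f] A(1) by (auto simp: rays_def)
qed

text \<open>\<open>A0\<close> is the component of a tail of \<open>r\<close> after deletion of a
  finite set that separates rays of the two ends. An infinite set with finite boundary contains a
  ray, hence a tail of \<open>r\<close> or of \<open>s\<close>. So each half holds exactly one end,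
  and if two halves hold the same end, their differences hold none and are finite.\<close>

lemma two_ended_halves:
  assumes "two_ended V E"
  obtains A0 where "half A0"
    "\<And>A B. half A \<Longrightarrow> half B \<Longrightarrow> almost_equal A B \<or> almost_equal A (V - B)"
proof -
  note eq = equiv_ray_equiv[of V E]
  obtain X Y where XY: "graph_ends V E = {X, Y}" "X \<noteq> Y"
    using assms by (auto simp: two_ended_def card_2_iff)
  then have quot: "X \<in> rays V E // ray_equiv V E" "Y \<in> rays V E // ray_equiv V E"
    by (simp_all flip: graph_ends_def)
  obtain r where r: "r \<in> rays V E" "X = ray_equiv V E `` {r}"
    using quot(1) by (rule quotientE)
  obtain s where s: "s \<in> rays V E" "Y = ray_equiv V E `` {s}"
    using quot(2) by (rule quotientE)
  have cover: "(r, t) \<in> ray_equiv V E \<or> (s, t) \<in> ray_equiv V E" if t: "t \<in> rays V E" for t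
  proof -
    have "ray_equiv V E `` {t} \<in> graph_ends V E"
      unfolding graph_ends_def by (rule quotientI[OF t])
    then have "ray_equiv V E `` {r} = ray_equiv V E `` {t} \<or> ray_equiv V E `` {s} = ray_equiv V E `` {t}"
      unfolding XY(1) r(2) s(2) by (elim insertE emptyE) simp_all
    then show ?thesis
      by (simp only: eq_equiv_class_iff[OF eq r(1) t] eq_equiv_class_iff[OF eq s(1) t])
  qed
  have "(r, s) \<notin> ray_equiv V E" using XY r s equiv_class_eq[OF eq] by blast
  then obtain F where F: "finite F" "F \<subseteq> E" "separates E F r s"
    using r s by (auto simp: ray_equiv_def)
  then obtain N where N: "\<And>i j. i \<ge> N \<Longrightarrow> j \<ge> N \<Longrightarrow> \<not> joined (E - F) (r i) (s j)"
    by (auto simp: separates_def)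
  obtain M where M: "\<And>i j. i \<ge> M \<Longrightarrow> j \<ge> M \<Longrightarrow> joined (E - F) (r i) (r j)"
    using ray_tail_joined[OF r(1) F(1)] by metis
  define K where "K = max M N"
  define A0 where "A0 = {v \<in> V. joined (E - F) (r K) v}"
  have "cob A0 \<subseteq> F"
  proof
    fix e assume "e \<in> cob A0"
    then obtain u v where uv: "e = {u, v}" "{u, v} \<in> E" "u \<in> V" "v \<in> V" "u \<in> A0" "v \<notin> A0"
      by (rule cobE)
    show "e \<in> F"
    proof (rule ccontr)
      assume "e \<notin> F"
      then have "joined (E - F) u v" using uv by (auto simp: joined_def adj_rel_def)
      then have "v \<in> A0" using uv unfolding A0_def by (auto intro: joined_trans)
      with uv show False by simp
    qed
  qed
  then have fin0: "finite (cob A0)" using F(1) finite_subset by blast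
  have rays_V: "t i \<in> V" "inj t" if "t \<in> rays V E" for t i using that by (auto simp: rays_def)
  have r0: "eventually_in r A0"
    unfolding A0_def using M rays_V(1)[OF r(1)] by (intro exI[of _ K]) (auto simp: K_def)
  have s0: "eventually_in s (V - A0)"
    unfolding A0_def using N[of K] rays_V(1)[OF s(1)] by (intro exI[of _ K]) (auto simp: K_def)
  have half0: "half A0"
    unfolding half_def using fin0 eventually_in_infinite[OF rays_V(2)[OF r(1)] r0]
      eventually_in_infinite[OF rays_V(2)[OF s(1)] s0] by (auto simp: A0_def)
  have infinite_side: "eventually_in r A \<or> eventually_in s A"
    if A: "A \<subseteq> V" "infinite A" "finite (cob A)" for A
  proof -
    obtain t where t: "t \<in> rays V E" "range t \<subseteq> A" using ray_in_infinite[OF A] .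
    have "eventually_in t A" using t by auto
    moreover have "(t, r) \<in> ray_equiv V E \<or> (t, s) \<in> ray_equiv V E"
      using cover[OF t(1)] eq by (meson equivE symE)
    ultimately show ?thesis using ray_equiv_side A(3) by blast
  qed
  have one_side: "eventually_in r A \<longleftrightarrow> \<not> eventually_in s A" if A: "half A" for A
  proof -
    have "eventually_in r A \<or> eventually_in s A"
      using infinite_side A by (simp add: half_def)
    moreover have "eventually_in r (V - A) \<or> eventually_in s (V - A)"
      by (intro infinite_side) (use half_compl[OF A] in \<open>auto simp: half_def\<close>)
    moreover have "\<not> (eventually_in t A \<and> eventually_in t (V - A))" for t
      using eventually_in_disjoint[of t A "V - A"] by blast
    ultimately show ?thesis by blast
  qed
  have diff: "finite (A - B)" if A: "half A" and B: "half B"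
    and same: "eventually_in r A \<longleftrightarrow> eventually_in r B" for A B
  proof (rule ccontr)
    assume "infinite (A - B)"
    moreover have "finite (cob (A - B))"
      using cob_diff[of A B] A B finite_subset by (auto simp: half_def)
    ultimately have ev: "eventually_in r (A - B) \<or> eventually_in s (A - B)"
      using infinite_side[of "A - B"] A by (auto simp: half_def)
    have no: "\<not> (eventually_in t B \<and> eventually_in t (A - B))" for t
      using eventually_in_disjoint[of t B "A - B"] by blast
    have sub: "eventually_in t (A - B) \<Longrightarrow> eventually_in t A" for t by blast
    show False using ev no sub same one_side[OF A] one_side[OF B] by blast
  qed
  have "almost_equal A B \<or> almost_equal A (V - B)" if A: "half A" and B: "half B" for A B
  proof (cases "eventually_in r A \<longleftrightarrow> eventually_in r B")
    case True
    then show ?thesis using diff A B by blast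
  next
    case False
    have "eventually_in r B \<longleftrightarrow> \<not> eventually_in r (V - B)"
      using ray_side[OF r(1)] B eventually_in_disjoint[of r B "V - B"] unfolding half_def by blast
    then have "eventually_in r A \<longleftrightarrow> eventually_in r (V - B)" using False by blast
    then show ?thesis using diff[OF A half_compl[OF B]] diff[OF half_compl[OF B] A] by blast
  qed
  with half0 that show ?thesis by blast
qed

end

section \<open>The height function\<close>

lemma almost_equal_trans:
  assumes "almost_equal A B" "almost_equal B C" shows "almost_equal A C"
proof -
  have "A - C \<subseteq> (A - B) \<union> (B - C)" "C - A \<subseteq> (C - B) \<union> (B - A)" by blast+
  with assms show ?thesis by (meson finite_UnI finite_subset)
qed

lemma almost_equal_compl:
  assumes "A \<subseteq> V" "B \<subseteq> V" "almost_equal A B" shows "almost_equal (V - A) (V - B)"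
proof -
  have "(V - A) - (V - B) = B - A" "(V - B) - (V - A) = A - B" using assms by blast+
  with assms show ?thesis by simp
qed

text \<open>A substitute for the difference of the cardinalities of two almost equal infinite sets.\<close>

definition card_diff :: "'b set \<Rightarrow> 'b set \<Rightarrow> int" where
  "card_diff A B = int (card (A - B)) - int (card (B - A))"

text \<open>Any finite window \<open>K\<close> around the symmetric difference serves for counting;
  a common window for three sets makes \<open>card_diff\<close> additive.\<close>

lemma card_diff_via:
  assumes "finite K" "A - B \<subseteq> K" "B - A \<subseteq> K"
  shows "card_diff A B = int (card (A \<inter> K)) - int (card (B \<inter> K))"
proof -
  have "A \<inter> K = (A - B) \<union> (A \<inter> B \<inter> K)" "B \<inter> K = (B - A) \<union> (A \<inter> B \<inter> K)"
    using assms by blast+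
  moreover have "card ((A - B) \<union> (A \<inter> B \<inter> K)) = card (A - B) + card (A \<inter> B \<inter> K)"
    "card ((B - A) \<union> (A \<inter> B \<inter> K)) = card (B - A) + card (A \<inter> B \<inter> K)"
    using assms by (intro card_Un_disjoint; auto intro: finite_subset)+
  ultimately show ?thesis by (simp add: card_diff_def)
qed

lemma card_diff_trans:
  assumes "almost_equal A B" "almost_equal B C"
  shows "card_diff A C = card_diff A B + card_diff B C"
proof -
  let ?K = "(A - B) \<union> (B - A) \<union> (B - C) \<union> (C - B)"
  have "finite ?K" using assms by simp
  then have "card_diff A C = int (card (A \<inter> ?K)) - int (card (C \<inter> ?K))"
    "card_diff A B = int (card (A \<inter> ?K)) - int (card (B \<inter> ?K))"
    "card_diff B C = int (card (B \<inter> ?K)) - int (card (C \<inter> ?K))"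
    by (intro card_diff_via; blast)+
  then show ?thesis by simp
qed

lemma card_diff_image:
  assumes g: "inj_on g V" and "A \<subseteq> V" "B \<subseteq> V"
  shows "card_diff (g ` A) (g ` B) = card_diff A B"
proof -
  have "card (g ` (A - B)) = card (A - B)" "card (g ` (B - A)) = card (B - A)"
    using assms by (intro card_image inj_on_subset[OF g]; blast)+
  moreover have "g ` (A - B) = g ` A - g ` B" "g ` (B - A) = g ` B - g ` A"
    using assms by (intro inj_on_image_set_diff[OF g]; blast)+
  ultimately show ?thesis by (simp add: card_diff_def)
qed

lemma card_diff_compl:
  assumes "A \<subseteq> V" "B \<subseteq> V" shows "card_diff (V - A) (V - B) = - card_diff A B"
proof -
  have "(V - A) - (V - B) = B - A" "(V - B) - (V - A) = A - B" using assms by blast+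
  then show ?thesis by (simp add: card_diff_def)
qed

section \<open>Balls, and how automorphisms move balls and cuts\<close>

context transitive_graph
begin

definition ball :: "nat \<Rightarrow> 'a \<Rightarrow> 'a set" where
  "ball n v = {x. \<exists>k\<le>n. (v, x) \<in> adj_rel E ^^ k}"

lemma ball_center: "v \<in> ball n v"
  unfolding ball_def by (auto intro: exI[of _ 0])

lemma ball_0: "ball 0 v = {v}"
  by (auto simp: ball_def)

lemma ball_Suc: "ball (Suc n) v = ball n v \<union> (\<Union>x\<in>ball n v. nb x)"
proof
  show "ball (Suc n) v \<subseteq> ball n v \<union> (\<Union>x\<in>ball n v. nb x)"
  proof
    fix y assume "y \<in> ball (Suc n) v"
    then obtain k where k: "k \<le> Suc n" "(v, y) \<in> adj_rel E ^^ k" by (auto simp: ball_def)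
    show "y \<in> ball n v \<union> (\<Union>x\<in>ball n v. nb x)"
    proof (cases k)
      case 0
      then show ?thesis using k ball_center by auto
    next
      case (Suc m)
      then obtain x where "(v, x) \<in> adj_rel E ^^ m" "(x, y) \<in> adj_rel E" using k by auto
      then show ?thesis using k Suc by (auto simp: ball_def adj_rel_def)
    qed
  qed
  show "ball n v \<union> (\<Union>x\<in>ball n v. nb x) \<subseteq> ball (Suc n) v"
  proof
    fix y assume "y \<in> ball n v \<union> (\<Union>x\<in>ball n v. nb x)"
    then consider "y \<in> ball n v" | x where "x \<in> ball n v" "(x, y) \<in> adj_rel E"
      by (auto simp: adj_rel_def)
    then show "y \<in> ball (Suc n) v"
    proof cases
      case 1
      then show ?thesis unfolding ball_def by (auto intro: le_SucI)
    next
      case 2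
      then obtain k where "k \<le> n" "(v, x) \<in> adj_rel E ^^ k" by (auto simp: ball_def)
      with 2 have "(v, y) \<in> adj_rel E ^^ Suc k" "Suc k \<le> Suc n" by auto
      then show ?thesis unfolding ball_def by blast
    qed
  qed
qed

lemma finite_ball: "finite (ball n v)"
  by (induction n) (auto simp: ball_0 ball_Suc finite_nb)

lemma ball_mono: "m \<le> n \<Longrightarrow> ball m v \<subseteq> ball n v"
  unfolding ball_def using order_trans by blast

lemma ball_trans: "x \<in> ball m u \<Longrightarrow> y \<in> ball n x \<Longrightarrow> y \<in> ball (m + n) u"
  unfolding ball_def by clarsimp (meson add_mono relpow_trans)

lemma ball_sym: "x \<in> ball n v \<Longrightarrow> v \<in> ball n x"
proof -
  have rev: "(v, x) \<in> adj_rel E ^^ k \<Longrightarrow> (x, v) \<in> adj_rel E ^^ k" for k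
  proof (induction k arbitrary: x)
    case (Suc k)
    then obtain y where y: "(v, y) \<in> adj_rel E ^^ k" "(y, x) \<in> adj_rel E" by auto
    then have "(x, y) \<in> adj_rel E" by (auto simp: adj_rel_def insert_commute)
    with Suc.IH[OF y(1)] show ?case by (intro relpow_Suc_I2)
  qed simp
  assume "x \<in> ball n v"
  with rev show ?thesis unfolding ball_def by blast
qed

lemma ball_exhaust: assumes "u \<in> V" "v \<in> V" shows "\<exists>n. v \<in> ball n u"
  using assms
proof (induction rule: connected_induct)
  case base
  show ?case using ball_center by blast
next
  case (step x y)
  then obtain n where "x \<in> ball n u" by blast
  then have "y \<in> ball (Suc n) u" using step by (auto simp: ball_Suc)
  then show ?case by blast
qed

lemma finite_subset_ball:
  assumes "u \<in> V" "finite S" "S \<subseteq> V" shows "\<exists>n. S \<subseteq> ball n u"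
  using assms(2,3)
proof (induction rule: finite_induct)
  case (insert x S)
  then obtain n m where "S \<subseteq> ball n u" "x \<in> ball m u" using ball_exhaust[OF assms(1)] by blast
  then have "insert x S \<subseteq> ball (max n m) u"
    using ball_mono[of n "max n m" u] ball_mono[of m "max n m" u] by auto
  then show ?case by blast
qed simp

lemma ball_aut: assumes g: "aut g" and v: "v \<in> V" shows "x \<in> ball n v \<Longrightarrow> x \<in> V \<and> g x \<in> ball n (g v)"
proof (induction n arbitrary: x)
  case 0
  then show ?case using v by (simp add: ball_0)
next
  case (Suc n)
  then consider "x \<in> ball n v" | y where "y \<in> ball n v" "{y, x} \<in> E" by (auto simp: ball_Suc)
  then show ?case
  proof cases
    case 1
    then show ?thesis using Suc.IH by (auto simp: ball_Suc)
  next
    case 2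
    then have "y \<in> V" "x \<in> V" "g y \<in> ball n (g v)" "{g y, g x} \<in> E"
      using Suc.IH edgeD[of y x] aut_edge[OF g, of y x] by auto
    then show ?thesis by (auto simp: ball_Suc)
  qed
qed

text \<open>Every vertex of a ball is joined to the centre within the ball, so a boundary with no
  edge inside cannot split it. The induction runs over radii \<open>m\<close> inside the fixed
  ball.\<close>

lemma ball_one_side:
  assumes "\<And>e. e \<in> cob B \<Longrightarrow> \<not> e \<subseteq> ball n v"
  shows "x \<in> ball n v \<Longrightarrow> x \<in> B \<longleftrightarrow> v \<in> B"
proof -
  have "m \<le> n \<Longrightarrow> x \<in> ball m v \<Longrightarrow> x \<in> B \<longleftrightarrow> v \<in> B" for m
  proof (induction m arbitrary: x)
    case 0
    then show ?case by (simp add: ball_0)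
  next
    case (Suc m)
    from Suc.prems(2) consider "x \<in> ball m v" | y where "y \<in> ball m v" "{y, x} \<in> E"
      by (auto simp: ball_Suc)
    then show ?case
    proof cases
      case 1
      then show ?thesis using Suc by simp
    next
      case 2
      have "{y, x} \<subseteq> ball n v"
        using 2 Suc.prems ball_mono[of m n v] ball_mono[of "Suc m" n v] by auto
      then have "{y, x} \<notin> cob B" using assms by blast
      then have "x \<in> B \<longleftrightarrow> y \<in> B" using edge_cob[OF 2(2)] by blast
      then show ?thesis using Suc.IH 2(1) Suc.prems(1) by simp
    qed
  qed
  then show "x \<in> ball n v \<Longrightarrow> x \<in> B \<longleftrightarrow> v \<in> B" by blast
qed

lemma aut_compl: "aut g \<Longrightarrow> A \<subseteq> V \<Longrightarrow> g ` (V - A) = V - g ` A"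
  using inj_on_image_set_diff[OF aut_inj, of g V A] aut_surj[of g] by simp

lemma cob_image:
  assumes g: "aut g" and A: "A \<subseteq> V" and e: "e \<in> cob (g ` A)"
  obtains e' where "e' \<in> cob A" "e = g ` e'"
proof -
  obtain x y where xy: "e = {x, y}" "{x, y} \<in> E" "x \<in> V" "y \<in> V" "x \<in> g ` A" "y \<notin> g ` A"
    using e by (rule cobE)
  obtain u where u: "u \<in> A" "x = g u" using xy by blast
  obtain v where v: "v \<in> V" "y = g v" using xy aut_surj[OF g] by blast
  have "v \<notin> A" using v xy by blast
  moreover have "{u, v} \<in> E" using aut_edge[OF g, of u v] u v A xy by auto
  ultimately have "{u, v} \<in> cob A" using u edge_cob by simp
  then show ?thesis using that[of "{u, v}"] u v xy by simp
qed

lemma half_image: assumes g: "aut g" and A: "half A" shows "half (g ` A)"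
proof -
  have AV: "A \<subseteq> V" using A by (simp add: half_def)
  have "cob (g ` A) \<subseteq> (`) g ` cob A" using cob_image[OF g AV] by blast
  moreover have "finite ((`) g ` cob A)" using A by (simp add: half_def)
  ultimately have "finite (cob (g ` A))" by (rule finite_subset)
  moreover have "inj_on g A" "inj_on g (V - A)"
    using AV by (auto intro: inj_on_subset[OF aut_inj[OF g]])
  then have "infinite (g ` A)" "infinite (g ` (V - A))"
    using A by (simp_all add: half_def finite_image_iff)
  moreover have "g ` A \<subseteq> V" using aut_surj[OF g] AV by blast
  ultimately show ?thesis by (simp add: half_def aut_compl[OF g AV])
qed

lemma half_cob_nonempty: "half A \<Longrightarrow> cob A \<noteq> {}"
  using cob_empty[of A] by (auto simp: half_def)

lemma almost_equal_image:
  assumes "aut g" "A \<subseteq> V" "B \<subseteq> V" "almost_equal A B"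
  shows "almost_equal (g ` A) (g ` B)"
  using inj_on_image_set_diff[OF aut_inj[OF assms(1)], of A B]
    inj_on_image_set_diff[OF aut_inj[OF assms(1)], of B A] assms by (metis Diff_subset finite_imageI order_trans)

end

text \<open>Two-endedness enters the height function only through these two facts; inside this
  locale no rays occur.\<close>

locale two_sided_graph = transitive_graph +
  fixes A0
  assumes half0: "half A0"
    and dichotomy: "half A \<Longrightarrow> half B \<Longrightarrow> almost_equal A B \<or> almost_equal A (V - B)"
begin

text \<open>A set and its complement have the same boundary. Being almost equal to \<open>A0\<close>
  picks the side at the end of \<open>A0\<close>, so each cut is counted once and is comparable with
  \<open>A0\<close> by \<open>card_diff\<close>.\<close>

definition cuts :: "nat \<Rightarrow> 'a \<Rightarrow> 'a set set" where
  "cuts n v = {A. half A \<and> almost_equal A A0 \<and> \<Union>(cob A) \<subseteq> ball n v}"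

text \<open>Vertices far towards the end of \<open>A0\<close> have cuts with smaller sides, so the
  height falls in that direction.\<close>

definition height :: "nat \<Rightarrow> 'a \<Rightarrow> int" where
  "height n v = (\<Sum>A\<in>cuts n v. card_diff A A0)"

text \<open>Passing to the complement keeps the image on the same side as \<open>A0\<close> when \<open>g\<close> swaps the ends.\<close>

definition transport :: "('a \<Rightarrow> 'a) \<Rightarrow> 'a set \<Rightarrow> 'a set" where
  "transport g A = (if almost_equal (g ` A0) A0 then g ` A else V - g ` A)"

lemma A0_V: "A0 \<subseteq> V"
  using half0 by (simp add: half_def)

lemma cutsD: "A \<in> cuts n v \<Longrightarrow> half A \<and> A \<subseteq> V \<and> almost_equal A A0 \<and> \<Union>(cob A) \<subseteq> ball n v"
  by (auto simp: cuts_def half_def)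

text \<open>A cut is determined by its boundary, a set of edges in a finite ball: if two boundaries
  agree, the symmetric difference of the cuts has none, so it is empty or \<open>V\<close>, and it
  is finite while \<open>V\<close> is not.\<close>

lemma finite_cuts: "finite (cuts n v)"
proof (rule finite_imageD)
  have "cob ` cuts n v \<subseteq> Pow (Pow (ball n v))" by (auto simp: cuts_def)
  then show "finite (cob ` cuts n v)" by (rule finite_subset) (simp add: finite_ball)
  show "inj_on cob (cuts n v)"
  proof (rule inj_onI)
    fix A B assume A: "A \<in> cuts n v" and B: "B \<in> cuts n v" and eq: "cob A = cob B"
    let ?C = "(A - B) \<union> (B - A)"
    have "cob ?C = {}"
    proof (rule ccontr)
      assume "cob ?C \<noteq> {}"
      then obtain e where "e \<in> cob ?C" by blast
      then obtain x y where xy: "{x, y} \<in> E" "x \<in> ?C" "y \<notin> ?C" by (rule cobE)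
      then show False using edge_cob[OF xy(1), of A] edge_cob[OF xy(1), of B] eq by auto
    qed
    moreover have "?C \<subseteq> V" using cutsD[OF A] cutsD[OF B] by blast
    ultimately have "?C = {} \<or> ?C = V" by (rule cob_empty)
    moreover have "almost_equal A B"
      using cutsD[OF A] cutsD[OF B] almost_equal_trans[of A A0 B] by blast
    then have "finite ?C" by blast
    moreover have "infinite V" using half0 by (auto simp: half_def)
    ultimately show "A = B" by auto
  qed
qed

lemma image_A0:
  assumes g: "aut g" and not: "\<not> almost_equal (g ` A0) A0"
  shows "almost_equal (V - g ` A0) A0"
proof -
  have "almost_equal (g ` A0) (V - A0)"
    using dichotomy[OF half_image[OF g half0] half0] not by blast
  then have "almost_equal (V - g ` A0) (V - (V - A0))"
    using aut_surj[OF g] A0_V by (intro almost_equal_compl) blast+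
  then show ?thesis using A0_V by (simp add: double_diff)
qed

lemma transport_cuts:
  assumes g: "aut g" and v: "v \<in> V" and A: "A \<in> cuts n v"
  shows "transport g A \<in> cuts n (g v)"
proof -
  note A' = cutsD[OF A]
  have gA: "g ` A \<subseteq> V" "g ` A0 \<subseteq> V" using aut_surj[OF g] A' A0_V by blast+
  have cob: "\<Union>(cob (g ` A)) \<subseteq> ball n (g v)"
  proof
    fix x assume "x \<in> \<Union>(cob (g ` A))"
    then obtain e where e: "e \<in> cob (g ` A)" "x \<in> e" by blast
    obtain e' where "e' \<in> cob A" "e = g ` e'" using cob_image[OF g _ e(1)] A' by metis
    then show "x \<in> ball n (g v)" using e A' ball_aut[OF g v] by blast
  qed
  have ae: "almost_equal (g ` A) (g ` A0)"
    using A' A0_V by (intro almost_equal_image[OF g]) auto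
  have half: "half (g ` A)" using half_image[OF g] A' by blast
  show ?thesis
  proof (cases "almost_equal (g ` A0) A0")
    case True
    then have "almost_equal (g ` A) A0" using almost_equal_trans[OF ae] by blast
    then show ?thesis using True cob half by (simp add: transport_def cuts_def)
  next
    case False
    have "almost_equal (V - g ` A) A0"
      using almost_equal_trans[OF almost_equal_compl[OF gA ae] image_A0[OF g False]] .
    then show ?thesis using False cob half_compl[OF half] cob_compl[OF gA(1)]
      unfolding transport_def cuts_def by (simp only: if_False mem_Collect_eq simp_thms)
  qed
qed

lemma transport_inj: assumes g: "aut g" shows "inj_on (transport g) (Pow V)"
proof (rule inj_onI)
  fix A B assume AB: "A \<in> Pow V" "B \<in> Pow V" "transport g A = transport g B"
  have "g ` A \<subseteq> V" "g ` B \<subseteq> V" using AB aut_surj[OF g] by blast+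
  then have "g ` A = g ` B" using AB(3) unfolding transport_def by (metis double_diff order_refl)
  then show "A = B" using AB inj_on_image_eq_iff[OF aut_inj[OF g], of A B] by blast
qed

lemma cuts_inj: "aut g \<Longrightarrow> inj_on (transport g) (cuts n v)"
  using inj_on_subset[OF transport_inj] cutsD by (metis PowI subsetI)

lemma card_cuts_eq:
  assumes "u \<in> V" "v \<in> V" shows "card (cuts n u) = card (cuts n v)"
proof -
  have "card (cuts n u) \<le> card (cuts n v)" if uv: "u \<in> V" "v \<in> V" for u v
  proof -
    obtain g where g: "aut g" "g u = v" using aut_ex[OF uv] by blast
    show ?thesis
      using transport_cuts[OF g(1) uv(1)] g(2)
      by (intro card_inj_on_le[OF cuts_inj[OF g(1)] _ finite_cuts]) auto
  qed
  then show ?thesis using assms by (simp add: le_antisym)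
qed

text \<open>Surjectivity by counting: \<open>transport g\<close> is injective and the two finite
  families have equal size.\<close>

lemma transport_image_cuts:
  assumes g: "aut g" and v: "v \<in> V" shows "transport g ` cuts n v = cuts n (g v)"
proof (rule card_subset_eq)
  show "card (transport g ` cuts n v) = card (cuts n (g v))"
    using card_image[OF cuts_inj[OF g]] card_cuts_eq[OF v aut_in[OF g v]] by simp
qed (use finite_cuts transport_cuts[OF g v] in auto)

lemma card_diff_transport:
  assumes g: "aut g" and A: "A \<in> cuts n v"
  shows "card_diff (transport g A) A0 =
    (if almost_equal (g ` A0) A0 then 1 else -1) * card_diff A A0 + card_diff (transport g A0) A0"
proof -
  note A' = cutsD[OF A]
  have gA: "g ` A \<subseteq> V" "g ` A0 \<subseteq> V" using aut_surj[OF g] A' A0_V by blast+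
  have ae: "almost_equal (g ` A) (g ` A0)"
    using A' A0_V by (intro almost_equal_image[OF g]) auto
  have im: "card_diff (g ` A) (g ` A0) = card_diff A A0"
    using A' A0_V by (intro card_diff_image[OF aut_inj[OF g]]) auto
  show ?thesis
  proof (cases "almost_equal (g ` A0) A0")
    case True
    then show ?thesis
      using card_diff_trans[OF ae True] im by (simp add: transport_def)
  next
    case False
    then show ?thesis
      using card_diff_trans[OF almost_equal_compl[OF gA ae] image_A0[OF g False]]
        card_diff_compl[OF gA] im unfolding transport_def by (simp only: if_False)
  qed
qed

text \<open>Each summand changes by an affine map of slope \<open>?e\<close> whose constant depends
  on \<open>g\<close> only. All vertices have equally many cuts, so the constants cancel in
  differences.\<close>

lemma height_aut:
  assumes g: "aut g"
  shows "\<exists>\<epsilon>\<in>{1, -1}. \<forall>u\<in>V. \<forall>w\<in>V. height n (g u) - height n (g w) = \<epsilon> * (height n u - height n w)"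
proof -
  let ?e = "if almost_equal (g ` A0) A0 then 1 else -1 :: int"
  let ?c = "card_diff (transport g A0) A0"
  have h: "height n (g v) = ?e * height n v + int (card (cuts n v)) * ?c" if v: "v \<in> V" for v
  proof -
    have "height n (g v) = (\<Sum>A\<in>cuts n v. card_diff (transport g A) A0)"
      unfolding height_def transport_image_cuts[OF g v, symmetric]
      by (subst sum.reindex[OF cuts_inj[OF g]]) simp
    also have "\<dots> = (\<Sum>A\<in>cuts n v. ?e * card_diff A A0 + ?c)"
      by (intro sum.cong refl card_diff_transport[OF g])
    also have "\<dots> = ?e * height n v + int (card (cuts n v)) * ?c"
      unfolding height_def sum.distrib sum_distrib_left by simp
    finally show ?thesis .
  qed
  have "height n (g u) - height n (g w) = ?e * (height n u - height n w)" if "u \<in> V" "w \<in> V" for u w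
    using h[OF that(1)] h[OF that(2)] card_cuts_eq[OF that, of n] by (simp add: algebra_simps)
  moreover have "?e \<in> {1, -1}" by simp
  ultimately show ?thesis by blast
qed

text \<open>The radius has to cover the boundary of \<open>A0\<close> from one vertex only;
  transitivity does the rest.\<close>

lemma cuts_nonempty: "\<exists>n. \<forall>v\<in>V. cuts n v \<noteq> {}"
proof -
  obtain c where c: "c \<in> V" using V_nonempty by blast
  have "\<Union>(cob A0) \<subseteq> V" using cob_subset edgeD by (auto elim!: cobE)
  moreover have "finite (\<Union>(cob A0))" using half0 finite_Union_cob unfolding half_def by blast
  ultimately obtain n where "\<Union>(cob A0) \<subseteq> ball n c" using finite_subset_ball[OF c] by metis
  then have "A0 \<in> cuts n c" using half0 by (simp add: cuts_def)
  then have "card (cuts n c) > 0" using finite_cuts card_gt_0_iff by blast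
  then have "cuts n v \<noteq> {}" if "v \<in> V" for v
    using card_cuts_eq[OF c that, of n] by auto
  then show ?thesis by blast
qed

text \<open>
  The complement of \<open>A\<close> is linked to \<open>u\<close> without meeting the ball around \<open>v\<close>, so it lies on one side
  of \<open>B\<close>; being infinite, it cannot lie inside \<open>B\<close>.
\<close>

lemma cut_nested:
  assumes u: "u \<in> V" and A: "A \<in> cuts n u" and B: "B \<in> cuts n v"
    and v: "v \<in> A" and disj: "ball n u \<inter> ball n v = {}"
  shows "card_diff B A0 < card_diff A A0"
proof -
  note A' = cutsD[OF A] and B' = cutsD[OF B]
  have ne: "e \<noteq> {}" if "e \<in> cob C" for e C using that by (auto elim: cobE)
  have vA: "x \<in> A" if "x \<in> ball n v" for x
  proof -
    have "\<not> e \<subseteq> ball n v" if "e \<in> cob A" for e using ne[OF that] A' that disj by blast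
    from ball_one_side[OF this that] v show ?thesis by blast
  qed
  have uB: "x \<in> B \<longleftrightarrow> u \<in> B" if "x \<in> ball n u" for x
  proof -
    have "\<not> e \<subseteq> ball n u" if "e \<in> cob B" for e using ne[OF that] B' that disj by blast
    from ball_one_side[OF this that] show ?thesis by blast
  qed
  have "x \<in> V - A \<longrightarrow> (x \<in> B \<longleftrightarrow> u \<in> B)" if "x \<in> V" for x
    using u that
  proof (induction rule: connected_induct)
    case (step x y)
    show ?case
    proof
      assume y: "y \<in> V - A"
      show "y \<in> B \<longleftrightarrow> u \<in> B"
      proof (cases "x \<in> A")
        case True
        then have "{x, y} \<in> cob A" using edge_cob[OF step(1)] y by blast
        then show ?thesis using uB A' by blast
      next
        case False
        have "{x, y} \<notin> cob B" using B' vA y by blast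
        then show ?thesis using step edge_cob[OF step(1), of B] edgeD[OF step(1)] False by blast
      qed
    qed
  qed simp
  then have side: "x \<in> B \<longleftrightarrow> u \<in> B" if "x \<in> V - A" for x using that by blast
  have ae: "almost_equal B A" using almost_equal_trans[of B A0 A] A' B' by blast
  have "u \<notin> B"
  proof
    assume "u \<in> B"
    then have "V - A \<subseteq> B - A" using side by blast
    then show False using ae A' finite_subset by (auto simp: half_def)
  qed
  then have "B \<subseteq> A" using side B' by blast
  moreover have "B \<noteq> A"
  proof
    assume "B = A"
    obtain e where "e \<in> cob A" using half_cob_nonempty A' by blast
    then show False using ne \<open>B = A\<close> A' B' disj by blast
  qed
  ultimately have "B - A = {}" "A - B \<noteq> {}" by blast+
  then have "card (B - A) = 0" "card (A - B) > 0"
    using ae by (simp_all only: card_gt_0_iff card.empty simp_thms)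
  then have "card_diff B A < 0" by (simp add: card_diff_def)
  moreover have "card_diff B A0 = card_diff B A + card_diff A A0"
    using card_diff_trans[OF ae] A' by blast
  ultimately show ?thesis by simp
qed

text \<open>Choose \<open>v\<close> so far inside \<open>A0\<close> that it lies in all cuts at
  \<open>u\<close> and the two balls are disjoint. By \<open>cut_nested\<close> every summand at
  \<open>v\<close> is smaller than every summand at \<open>u\<close>, and both sums have equally
  many terms.\<close>

lemma height_descends:
  assumes ne: "\<forall>v\<in>V. cuts n v \<noteq> {}" and u: "u \<in> V"
  shows "\<exists>v\<in>V. height n v < height n u"
proof -
  have "finite (A0 - \<Inter>(cuts n u))"
  proof -
    have "A0 - \<Inter>(cuts n u) = (\<Union>A\<in>cuts n u. A0 - A)" by blast
    moreover have "finite (\<Union>A\<in>cuts n u. A0 - A)"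
      using cutsD by (intro finite_UN_I finite_cuts) blast
    ultimately show ?thesis by simp
  qed
  then have "infinite (A0 \<inter> \<Inter>(cuts n u))"
    using half0 by (metis Diff_Diff_Int finite_Diff2 half_def)
  then have "\<not> A0 \<inter> \<Inter>(cuts n u) \<subseteq> ball (n + n) u" using finite_ball finite_subset by blast
  then obtain v where v: "v \<in> A0" "\<And>A. A \<in> cuts n u \<Longrightarrow> v \<in> A" "v \<notin> ball (n + n) u" by blast
  have vV: "v \<in> V" using v A0_V by blast
  have disj: "ball n u \<inter> ball n v = {}" using ball_trans ball_sym v(3) by blast
  have less: "card_diff B A0 < card_diff A A0" if "A \<in> cuts n u" "B \<in> cuts n v" for A B
    using cut_nested[OF u that v(2)[OF that(1)] disj] .
  obtain A where A: "A \<in> cuts n u" using ne u by blast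
  \<comment> \<open>The least summand at \<open>u\<close> separates the two sums, whose index sets
    need no matching.\<close>
  define m where "m = Min ((\<lambda>A. card_diff A A0) ` cuts n u)"
  have "m \<in> (\<lambda>A. card_diff A A0) ` cuts n u"
    unfolding m_def using A finite_cuts by (intro Min_in) auto
  then have lt: "card_diff B A0 < m" if "B \<in> cuts n v" for B using less that by auto
  have "height n v < (\<Sum>B\<in>cuts n v. m)"
    unfolding height_def using ne vV finite_cuts lt by (intro sum_strict_mono) auto
  also have "\<dots> = (\<Sum>A\<in>cuts n u. m)" using card_cuts_eq[OF u vV, of n] by simp
  also have "\<dots> \<le> height n u"
    unfolding height_def m_def by (intro sum_mono Min_le) (auto simp: finite_cuts)
  finally show ?thesis using vV by blast
qed

end

text \<open>Real values, because the later correction adds a real multiple of a sign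
  function.\<close>

lemma (in transitive_graph) two_ended_height:
  assumes "two_ended V E"
  obtains h :: "'a \<Rightarrow> real" where
    "\<And>g. aut g \<Longrightarrow> \<exists>\<epsilon>\<in>{1, -1}. \<forall>u\<in>V. \<forall>w\<in>V. h (g u) - h (g w) = \<epsilon> * (h u - h w)"
    "\<And>u. u \<in> V \<Longrightarrow> \<exists>v\<in>V. h v < h u"
proof -
  obtain A0 where A0: "half A0"
    "\<And>A B. half A \<Longrightarrow> half B \<Longrightarrow> almost_equal A B \<or> almost_equal A (V - B)"
    using two_ended_halves[OF assms] by metis
  interpret two_sided_graph V E A0 by unfold_locales (use A0 in blast)+
  obtain n where n: "\<forall>v\<in>V. cuts n v \<noteq> {}" using cuts_nonempty by blast
  show ?thesis
  proof (rule that[of "\<lambda>v. real_of_int (height n v)"])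
    fix g assume "aut g"
    then obtain \<epsilon> where e: "\<epsilon> \<in> {1, -1}"
      "\<forall>u\<in>V. \<forall>w\<in>V. height n (g u) - height n (g w) = \<epsilon> * (height n u - height n w)"
      using height_aut by blast
    then show "\<exists>\<epsilon>\<in>{1, -1}. \<forall>u\<in>V. \<forall>w\<in>V. real_of_int (height n (g u)) - real_of_int (height n (g w))
        = \<epsilon> * (real_of_int (height n u) - real_of_int (height n w))"
      by (intro bexI[of _ "real_of_int \<epsilon>"]) (auto simp flip: of_int_diff of_int_mult)
  next
    fix u assume "u \<in> V"
    then show "\<exists>v\<in>V. real_of_int (height n v) < real_of_int (height n u)"
      using height_descends[OF n] by auto
  qed
qed

section \<open>Local shapes of the height function\<close>

lemma card_ge_2_obtain:
  assumes "2 \<le> card A" obtains x y where "x \<in> A" "y \<in> A" "x \<noteq> y"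
proof -
  have "finite A" using assms card.infinite by fastforce
  then have "\<not> (\<forall>x\<in>A. \<forall>y\<in>A. x = y)" using card_le_Suc0_iff_eq[of A] assms by simp
  then show ?thesis using that by blast
qed

lemma sum_zero_pos:
  fixes f :: "'b \<Rightarrow> real"
  assumes "finite A" "(\<Sum>a\<in>A. f a) = 0" "a \<in> A" "f a \<noteq> 0"
  shows "\<exists>b\<in>A. 0 < f b"
proof (rule ccontr)
  assume "\<not> ?thesis"
  then have "\<And>b. b \<in> A \<Longrightarrow> 0 \<le> - f b" by force
  moreover have "(\<Sum>a\<in>A. - f a) = 0" using assms(2) by (simp add: sum_negf)
  ultimately have "\<forall>b\<in>A. - f b = 0" using sum_nonneg_eq_0_iff[OF assms(1), of "\<lambda>b. - f b"] by blast
  with assms show False by simp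
qed

context transitive_graph
begin

abbreviation up :: "('a \<Rightarrow> real) \<Rightarrow> 'a \<Rightarrow> 'a set" where
  "up k v \<equiv> {w \<in> nb v. k v < k w}"

abbreviation down :: "('a \<Rightarrow> real) \<Rightarrow> 'a \<Rightarrow> 'a set" where
  "down k v \<equiv> {w \<in> nb v. k w < k v}"

lemma nb_V: "w \<in> nb v \<Longrightarrow> w \<in> V \<and> v \<in> V"
  using edgeD by blast

lemma finite_up: "finite (up k v)" and finite_down: "finite (down k v)"
  using finite_nb[of v] by simp_all

lemma Collect_nb_image:
  assumes g: "aut g" and v: "v \<in> V" and eq: "\<And>w. w \<in> nb v \<Longrightarrow> Q (g w) \<longleftrightarrow> P w"
  shows "{w \<in> nb (g v). Q w} = g ` {w \<in> nb v. P w}"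
  unfolding aut_nb[OF g v] using eq by blast

lemma card_image_nb:
  assumes "aut g" "v \<in> V" "A \<subseteq> nb v" shows "card (g ` A) = card A"
  using assms nb_V by (intro card_image inj_on_subset[OF aut_inj]) auto

lemma up_down_image:
  assumes g: "aut g" and v: "v \<in> V" and eq: "\<forall>u\<in>V. \<forall>w\<in>V. k (g u) - k (g w) = k u - k w"
  shows "up k (g v) = g ` up k v" "down k (g v) = g ` down k v"
proof -
  have "k (g w) - k (g v) = k w - k v" if "w \<in> nb v" for w using eq that nb_V by blast
  then have "k (g v) < k (g w) \<longleftrightarrow> k v < k w" "k (g w) < k (g v) \<longleftrightarrow> k w < k v"
    if "w \<in> nb v" for w using that by (smt (verit))+
  then show "up k (g v) = g ` up k v" "down k (g v) = g ` down k v"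
    by (intro Collect_nb_image[OF g v]; blast)+
qed

lemma up_down_image_flip:
  assumes g: "aut g" and v: "v \<in> V" and eq: "\<forall>u\<in>V. \<forall>w\<in>V. k (g u) - k (g w) = k w - k u"
  shows "up k (g v) = g ` down k v" "down k (g v) = g ` up k v"
proof -
  have "k (g w) - k (g v) = k v - k w" if "w \<in> nb v" for w using eq that nb_V by blast
  then have "k (g v) < k (g w) \<longleftrightarrow> k w < k v" "k (g w) < k (g v) \<longleftrightarrow> k v < k w"
    if "w \<in> nb v" for w using that by (smt (verit))+
  then show "up k (g v) = g ` down k v" "down k (g v) = g ` up k v"
    by (intro Collect_nb_image[OF g v]; blast)+
qed

lemma nonconstant_edge:
  fixes k :: "'a \<Rightarrow> real"
  assumes "u \<in> V" "v \<in> V" "k u \<noteq> k v"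
  shows "\<exists>x y. {x, y} \<in> E \<and> k x < k y"
proof (rule ccontr)
  assume no: "\<not> ?thesis"
  from assms(1,2) have "k v = k u"
  proof (induction rule: connected_induct)
    case (step x y)
    then have "\<not> k x < k y" "\<not> k y < k x" using no edge_sym by blast+
    with step show ?case by simp
  qed simp
  with assms show False by simp
qed

lemma path_or_branch:
  fixes k :: "'a \<Rightarrow> real"
  assumes not_path: "\<not> isomorphic_graphs V E (UNIV :: int set) two_way_path_edges"
    and no_level: "\<And>v w. {v, w} \<in> E \<Longrightarrow> k v \<noteq> k w"
    and "\<And>v. v \<in> V \<Longrightarrow> card (up k v) = 1" "\<And>v. v \<in> V \<Longrightarrow> card (down k v) = 1"
  shows False
proof -
  have "\<exists>x y. nb v = {x, y} \<and> k v < k x \<and> k y < k v" if v: "v \<in> V" for v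
  proof -
    obtain x y where "up k v = {x}" "down k v = {y}" using assms(3,4)[OF v] by (meson card_1_singletonE)
    moreover have "nb v = up k v \<union> down k v" using no_level[of v] by force
    ultimately show ?thesis by blast
  qed
  then show False using isomorphic_two_way_path not_path by blast
qed

lemma growth_translation_case:
  fixes k :: "'a \<Rightarrow> real"
  assumes not_path: "\<not> isomorphic_graphs V E (UNIV :: int set) two_way_path_edges"
    and inv: "\<And>g. aut g \<Longrightarrow> \<forall>u\<in>V. \<forall>w\<in>V. k (g u) - k (g w) = k u - k w"
    and edge: "{x, y} \<in> E" "k x < k y"
  shows golden_growth
proof -
  have xy: "x \<in> V" "y \<in> V" using edgeD[OF edge(1)] by auto
  have up_card: "card (up k u) = card (up k v)" and down_card: "card (down k u) = card (down k v)"
    if uv: "u \<in> V" "v \<in> V" for u v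
  proof -
    obtain g where g: "aut g" "g u = v" using aut_ex[OF uv] by blast
    have "up k v = g ` up k u" "down k v = g ` down k u"
      using up_down_image[OF g(1) uv(1) inv[OF g(1)]] g(2) by simp_all
    moreover have "card (g ` up k u) = card (up k u)" "card (g ` down k u) = card (down k u)"
      by (intro card_image_nb[OF g(1) uv(1)]; blast)+
    ultimately show "card (up k u) = card (up k v)" "card (down k u) = card (down k v)" by simp_all
  qed
  \<comment> \<open>The edge shows an upper neighbour at \<open>x\<close> and a lower one at
    \<open>y\<close>; both counts are the same at all vertices, hence positive everywhere.\<close>
  have "y \<in> up k x" "x \<in> down k y" using edge edge_sym by auto
  then have pos: "0 < card (up k x)" "0 < card (down k y)"
    using finite_up finite_down card_gt_0_iff by blast+
  have ups: "0 < card (up k v)" and downs: "0 < card (down k v)" if "v \<in> V" for v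
    using pos up_card[OF xy(1) that] down_card[OF xy(2) that] by simp_all
  consider (level) u w where "{u, w} \<in> E" "k u = k w"
    | (up) "2 \<le> card (up k x)" | (down) "2 \<le> card (down k x)"
    | (path) "\<And>v w. {v, w} \<in> E \<Longrightarrow> k v \<noteq> k w" "card (up k x) = 1" "card (down k x) = 1"
  proof -
    have "2 \<le> card (up k x) \<or> card (up k x) = 1" "2 \<le> card (down k x) \<or> card (down k x) = 1"
      using ups[OF xy(1)] downs[OF xy(1)] by linarith+
    then show thesis using that by blast
  qed
  then show ?thesis
  proof cases
    case level
    show ?thesis
    proof (rule growth_level[of k])
      fix v assume v: "v \<in> V"
      have "up k v \<noteq> {}" using ups[OF v] by (metis card.empty less_numeral_extra(3))
      then show "\<exists>x\<in>nb v. k v < k x" by blast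
      have uw: "u \<in> V" "w \<in> V" using level edgeD by blast+
      obtain g where g: "aut g" "g u = v" using aut_ex[OF uw(1) v] by blast
      have "k (g w) - k (g u) = k w - k u" using inv[OF g(1)] uw by blast
      then have "k (g w) = k v" using level g by simp
      moreover have "{v, g w} \<in> E" using aut_edge[OF g(1) uw] level g by simp
      ultimately show "\<exists>x\<in>nb v. k x = k v" by blast
    qed
  next
    case up
    show ?thesis
    proof (rule growth_two_up[of k])
      fix v assume "v \<in> V"
      then have "2 \<le> card (up k v)" using up up_card[OF xy(1)] by simp
      then show "\<exists>x\<in>nb v. \<exists>y\<in>nb v. x \<noteq> y \<and> k v < k x \<and> k v < k y"
        by (rule card_ge_2_obtain) blast
    qed
  next
    case down
    show ?thesis
    proof (rule growth_two_up[of "\<lambda>v. - k v"])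
      fix v assume "v \<in> V"
      then have "2 \<le> card (down k v)" using down down_card[OF xy(1)] by simp
      then show "\<exists>x\<in>nb v. \<exists>y\<in>nb v. x \<noteq> y \<and> - k v < - k x \<and> - k v < - k y"
        by (rule card_ge_2_obtain) auto
    qed
  next
    case path
    have False
      using path(2,3) up_card[OF xy(1)] down_card[OF xy(1)]
      by (intro path_or_branch[OF not_path path(1)]) auto
    then show ?thesis ..
  qed
qed

section \<open>Heights that automorphisms may turn upside down\<close>

definition flip_invariant :: "('a \<Rightarrow> real) \<Rightarrow> bool" where
  "flip_invariant k \<longleftrightarrow> (\<forall>g. aut g \<longrightarrow>
     (\<forall>u\<in>V. \<forall>w\<in>V. k (g u) - k (g w) = k u - k w) \<or> (\<forall>u\<in>V. \<forall>w\<in>V. k (g u) - k (g w) = k w - k u))"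

definition harmonic :: "('a \<Rightarrow> real) \<Rightarrow> bool" where
  "harmonic k \<longleftrightarrow> (\<forall>v\<in>V. (\<Sum>w\<in>nb v. k w - k v) = 0)"

text \<open>
  In the proof below, the vertices in \<open>U\<close> look like \<open>c0\<close> and the others like \<open>c0\<close> upside down. The
  unique edge in the minority direction has height \<open>c\<close>, the sum of the other heights \<open>W\<close>, so upward
  edges alternate between \<open>U\<close> and its complement.
\<close>

lemma growth_alternating_case:
  fixes k :: "'a \<Rightarrow> real"
  assumes inv: "flip_invariant k" and harm: "harmonic k"
    and no_level: "\<And>v w. {v, w} \<in> E \<Longrightarrow> k v \<noteq> k w"
    and c0: "c0 \<in> V" "2 \<le> card (up k c0)" "card (down k c0) = 1"
  shows golden_growth
proof -
  define U where "U = {v \<in> V. card (down k v) = 1}"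
  define W where "W = (\<lambda>w. k w - k c0) ` up k c0"
  obtain e where e: "down k c0 = {e}" using c0(3) by (rule card_1_singletonE)
  define c where "c = k c0 - k e"
  have eV: "e \<in> V" and ce: "e \<in> nb c0" "k e < k c0" using e edgeD by blast+
  have UV: "U \<subseteq> V" "c0 \<in> U" using c0 by (auto simp: U_def)
  have typeU: "\<exists>g. aut g \<and> g c0 = v \<and> (\<forall>u\<in>V. \<forall>w\<in>V. k (g u) - k (g w) = k u - k w)"
    if v: "v \<in> U" for v
  proof -
    obtain g where g: "aut g" "g c0 = v" using aut_ex c0(1) v UV by blast
    \<comment> \<open>Counting decides the kind of \<open>g\<close>: a flip would give
      \<open>v\<close> at least two lower neighbours.\<close>
    have "\<not> (\<forall>u\<in>V. \<forall>w\<in>V. k (g u) - k (g w) = k w - k u)"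
    proof
      assume "\<forall>u\<in>V. \<forall>w\<in>V. k (g u) - k (g w) = k w - k u"
      from up_down_image_flip(2)[OF g(1) c0(1) this] have "card (down k v) = card (up k c0)"
        unfolding g(2) using card_image_nb[OF g(1) c0(1), of "up k c0"] by auto
      then show False using v c0(2) by (simp add: U_def)
    qed
    then show ?thesis using inv g unfolding flip_invariant_def by blast
  qed
  have typeD: "\<exists>g. aut g \<and> g c0 = v \<and> (\<forall>u\<in>V. \<forall>w\<in>V. k (g u) - k (g w) = k w - k u)"
    if v: "v \<in> V" "v \<notin> U" for v
  proof -
    obtain g where g: "aut g" "g c0 = v" using aut_ex c0(1) v by blast
    have "\<not> (\<forall>u\<in>V. \<forall>w\<in>V. k (g u) - k (g w) = k u - k w)"
    proof
      assume "\<forall>u\<in>V. \<forall>w\<in>V. k (g u) - k (g w) = k u - k w"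
      from up_down_image(2)[OF g(1) c0(1) this] have "card (down k v) = card (down k c0)"
        unfolding g(2) using card_image_nb[OF g(1) c0(1), of "down k c0"] by auto
      then show False using v c0(3) by (simp add: U_def)
    qed
    then show ?thesis using inv g unfolding flip_invariant_def by blast
  qed
  have U_up: "card (up k v) = card (up k c0)" "(\<lambda>w. k w - k v) ` up k v = W"
    and U_down: "\<And>w. w \<in> down k v \<Longrightarrow> k v - k w = c" if v: "v \<in> U" for v
  proof -
    obtain g where g: "aut g" "g c0 = v" "\<forall>u\<in>V. \<forall>w\<in>V. k (g u) - k (g w) = k u - k w"
      using typeU[OF v] by blast
    have im: "up k v = g ` up k c0" "down k v = {g e}"
      using up_down_image[OF g(1) c0(1) g(3)] g(2) e by auto
    show "card (up k v) = card (up k c0)"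
      unfolding im using card_image_nb[OF g(1) c0(1), of "up k c0"] by auto
    have "k (g w) - k v = k w - k c0" if "w \<in> V" for w using g c0(1) that by blast
    then show "(\<lambda>w. k w - k v) ` up k v = W"
      unfolding im W_def image_image using nb_V by (intro image_cong) auto
    have "k v - k (g e) = c" using g c0(1) eV unfolding c_def by blast
    then show "k v - k w = c" if "w \<in> down k v" for w using that unfolding im(2) by simp
  qed
  have D_down: "card (down k v) = card (up k c0)" "(\<lambda>w. k v - k w) ` down k v = W"
    and D_up: "\<exists>w. up k v = {w} \<and> k w - k v = c" if v: "v \<in> V" "v \<notin> U" for v
  proof -
    obtain g where g: "aut g" "g c0 = v" "\<forall>u\<in>V. \<forall>w\<in>V. k (g u) - k (g w) = k w - k u"
      using typeD[OF v] by blast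
    have im: "down k v = g ` up k c0" "up k v = {g e}"
      using up_down_image_flip[OF g(1) c0(1) g(3)] g(2) e by auto
    show "card (down k v) = card (up k c0)"
      unfolding im using card_image_nb[OF g(1) c0(1), of "up k c0"] by auto
    have "k v - k (g w) = k w - k c0" if "w \<in> V" for w using g c0(1) that by blast
    then show "(\<lambda>w. k v - k w) ` down k v = W"
      unfolding im W_def image_image using nb_V by (intro image_cong) auto
    have "k (g e) - k v = c" using g c0(1) eV unfolding c_def by blast
    then show "\<exists>w. up k v = {w} \<and> k w - k v = c" using im by blast
  qed
  have c_pos: "0 < c" using ce by (simp add: c_def)
  have W_pos: "0 < d" if "d \<in> W" for d using that by (auto simp: W_def)
  have W_less: "d < c" if d: "d \<in> W" for d
  proof -
    obtain w where w: "w \<in> up k c0" "d = k w - k c0" using d unfolding W_def by blast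
    \<comment> \<open>A second upper neighbour adds a positive term besides \<open>d\<close> to the
      sum that equals \<open>c\<close>.\<close>
    obtain w' where w': "w' \<in> up k c0" "w' \<noteq> w"
      using card_ge_2_obtain[OF c0(2)] by metis
    have nb: "nb c0 = up k c0 \<union> {e}" using no_level[of c0] unfolding e[symmetric] by force
    have "0 = (\<Sum>w\<in>nb c0. k w - k c0)" using harm c0(1) by (simp add: harmonic_def)
    also have "\<dots> = (\<Sum>w\<in>up k c0 \<union> {e}. k w - k c0)" by (rule sum.cong[OF nb]) simp
    also have "\<dots> = (\<Sum>w\<in>up k c0. k w - k c0) + (k e - k c0)"
      using ce by (subst sum.union_disjoint[OF finite_up]) auto
    finally have c_sum: "c = (\<Sum>w\<in>up k c0. k w - k c0)" by (simp add: c_def)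
    have "(\<Sum>w\<in>{w, w'}. k w - k c0) \<le> (\<Sum>w\<in>up k c0. k w - k c0)"
      using w w' by (intro sum_mono2 finite_up) auto
    then have "d + (k w' - k c0) \<le> c" using w w' c_sum by simp
    then show ?thesis using w' by simp
  qed
  have up_of_U: "w \<in> V \<and> w \<notin> U \<and> k w - k v \<in> W" if "v \<in> U" "w \<in> up k v" for v w
  proof -
    have d: "k w - k v \<in> W" using U_up(2)[OF that(1)] that(2) by blast
    \<comment> \<open>Seen from \<open>w\<close> the edge goes down; for \<open>w\<close> in
      \<open>U\<close> its height would be \<open>c\<close>, but heights in \<open>W\<close> are
      smaller.\<close>
    have "v \<in> down k w" using that(2) edge_sym by auto
    then have "w \<notin> U" using U_down[of w v] W_less[OF d] by auto
    then show ?thesis using d that nb_V by blast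
  qed
  have up_of_D: "w \<in> U \<and> k w - k v = c" if v: "v \<in> V" "v \<notin> U" and w: "w \<in> up k v" for v w
  proof -
    obtain w' where w': "up k v = {w'}" "k w' - k v = c" using D_up[OF v] by blast
    have "w \<in> {w'}" using w unfolding w'(1) .
    then have d: "k w - k v = c" using w'(2) by simp
    have wV: "w \<in> V" using w nb_V by blast
    \<comment> \<open>The reverse comparison: outside \<open>U\<close> the lower edges of
      \<open>w\<close> have heights in \<open>W\<close>, and this edge has height
      \<open>c\<close>.\<close>
    have "v \<in> down k w" using w edge_sym by auto
    then have "w \<notin> U \<Longrightarrow> k w - k v \<in> W" using D_down(2)[OF wV] by blast
    then have "w \<in> U" using W_less d by blast
    with d show ?thesis by blast
  qed
  have down_of_D: "w \<in> U \<and> k v - k w \<in> W" if "v \<in> V" "v \<notin> U" "w \<in> down k v" for v w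
  proof -
    have "w \<in> V" "v \<in> up k w" using that nb_V edge_sym by auto
    then have "w \<in> U" using up_of_D[of w v] that by blast
    then show ?thesis using D_down(2)[OF that(1,2)] that(3) by blast
  qed
  have D_ex: "\<exists>w\<in>up k v. w \<in> U \<and> k w - k v = c" if "v \<in> V" "v \<notin> U" for v
    using D_up[OF that] up_of_D[OF that] by blast
  show ?thesis
  proof (cases "3 \<le> card (up k c0)")
    case True
    show ?thesis
    proof (rule growth_three[of U k])
      show "3 \<le> card (up k s)" if "s \<in> U" for s using U_up(1)[OF that] True by simp
      show "\<exists>y\<in>nb x. y \<in> U \<and> k x < k y" if "s \<in> U" "x \<in> nb s" "k s < k x" for s x
        using D_ex[of x] up_of_U[of s x] that by blast
    qed (use UV in auto)
  next
    case False
    then have two: "card (up k c0) = 2" using c0(2) by simp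
    then obtain x' y' where "up k c0 = {x', y'}" unfolding card_2_iff by blast
    then have "up k c0 = {x', y'}" "up k c0 = {y', x'}" by (simp_all only: insert_commute)
    then obtain x y where up0: "up k c0 = {x, y}" "k y \<le> k x" using linear[of "k x'" "k y'"] by metis
    define a where "a = k x - k c0"
    define b where "b = k y - k c0"
    have W: "W = {a, b}" unfolding W_def up0 a_def b_def by simp
    have b_pos: "0 < b" using W_pos W by simp
    show ?thesis
    proof (cases "a = b")
      case True
      show ?thesis
      proof (rule growth_zigzag[of U k])
        fix s assume s: "s \<in> U"
        have "2 \<le> card (up k s)" using U_up(1)[OF s] two by simp
        then show "\<exists>x\<in>nb s. \<exists>y\<in>nb s. x \<noteq> y \<and> k s < k x \<and> k s < k y"
          by (rule card_ge_2_obtain) blast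
        fix x assume x: "x \<in> nb s" "k s < k x"
        have xD: "x \<in> V" "x \<notin> U" "k x = k s + a" using up_of_U[OF s, of x] x W True by auto
        obtain x' where x': "x' \<in> up k x" "x' \<in> U" "k x' = k x + c"
          using D_ex[OF xD(1,2)] by auto
        \<comment> \<open>As \<open>W\<close> has a single height, the second lower neighbour
          \<open>z\<close> of \<open>x\<close> is level with \<open>s\<close>, and the second upper
          neighbour \<open>w\<close> of \<open>z\<close> is level with \<open>x\<close>. The last
          step of each block, of height \<open>c\<close>, then rises above all earlier
          vertices.\<close>
        have "2 \<le> card (down k x)" using D_down(1)[OF xD(1,2)] two by simp
        then obtain z where z: "z \<in> down k x" "z \<noteq> s" by (rule card_ge_2_obtain) blast
        have zU: "z \<in> U" "k z = k s" using down_of_D[OF xD(1,2) z(1)] W True xD(3) by auto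
        have "2 \<le> card (up k z)" using U_up(1)[OF zU(1)] two by simp
        then obtain w where w: "w \<in> up k z" "w \<noteq> x" by (rule card_ge_2_obtain) blast
        have wD: "w \<in> V" "w \<notin> U" "k w = k s + a" using up_of_U[OF zU(1) w(1)] W True zU by auto
        obtain w' where w': "w' \<in> up k w" "w' \<in> U" "k w' = k w + c"
          using D_ex[OF wD(1,2)] by auto
        have a: "0 < a" using True b_pos by simp
        have E: "{s, x} \<in> E" "{x, x'} \<in> E" "{x, z} \<in> E" "{z, w} \<in> E" "{w, w'} \<in> E"
          using x x' z w w' by auto
        have "block k U s [x, x']"
          using E x'(2,3) xD(2,3) a c_pos s by (auto simp: block_def)
        moreover have "block k U s [x, z, w, w']"
          using E w'(2,3) xD(2,3) wD(2,3) zU z(2) w(2) a c_pos s by (auto simp: block_def)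
        moreover have "x' \<noteq> z" using x'(3) xD(3) zU a c_pos by auto
        ultimately show "\<exists>x' z w w'. block k U s [x, x'] \<and> block k U s [x, z, w, w'] \<and> x' \<noteq> z"
          by blast
      qed (use UV in auto)
    next
      case False
      then have ab: "b < a" using up0(2) by (simp add: a_def b_def)
      \<comment> \<open>The edges of height \<open>b\<close> join \<open>U\<close> to its complement and become level, all others still rise.\<close>
      define k' where "k' v = k v + (if v \<in> U then b / 2 else - b / 2)" for v
      have U_ex: "\<exists>w\<in>up k v. k w - k v = d" if "v \<in> U" "d \<in> W" for v d
        using U_up(2)[OF that(1)] that(2) by blast
      show ?thesis
      proof (rule growth_level[of k'])
        fix v assume v: "v \<in> V"
        show "\<exists>x\<in>nb v. k' v < k' x"
        proof (cases "v \<in> U")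
          case True
          then obtain w where "w \<in> up k v" "k w - k v = a" using U_ex[of v a] W by blast
          moreover from this True have "w \<notin> U" using up_of_U by blast
          ultimately show ?thesis using True ab by (intro bexI[of _ w]) (auto simp: k'_def)
        next
          case False
          then obtain w where "w \<in> up k v" "w \<in> U" "k w - k v = c" using D_ex[OF v] by blast
          then show ?thesis using False b_pos by (intro bexI[of _ w]) (auto simp: k'_def)
        qed
        show "\<exists>x\<in>nb v. k' x = k' v"
        proof (cases "v \<in> U")
          case True
          then obtain w where "w \<in> up k v" "k w - k v = b" using U_ex[of v b] W by blast
          moreover from this True have "w \<notin> U" using up_of_U by blast
          ultimately show ?thesis using True by (intro bexI[of _ w]) (auto simp: k'_def)
        next
          case False
          have "b \<in> (\<lambda>w. k v - k w) ` down k v" using D_down(2)[OF v False] W by simp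
          then obtain w where w: "w \<in> down k v" "k v - k w = b" by auto
          have "w \<in> U" using down_of_D[OF v False w(1)] by blast
          then show ?thesis using False w by (intro bexI[of _ w]) (auto simp: k'_def)
        qed
      qed
    qed
  qed
qed

text \<open>An automorphism keeps the numbers of upper and lower neighbours or exchanges them, so a
  bound for both at \<open>x\<close> holds everywhere. Without level edges, counts 1 and at least 2
  are the alternating case, for \<open>k\<close> or for its negative.\<close>

lemma growth_harmonic_case:
  fixes k :: "'a \<Rightarrow> real"
  assumes not_path: "\<not> isomorphic_graphs V E (UNIV :: int set) two_way_path_edges"
    and inv: "flip_invariant k" and harm: "harmonic k"
    and edge: "{x, y} \<in> E" "k x < k y"
  shows golden_growth
proof -
  have xy: "x \<in> V" "y \<in> V" using edgeD[OF edge(1)] by auto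
  have cards: "(card (up k v) = card (up k x) \<and> card (down k v) = card (down k x)) \<or>
      (card (up k v) = card (down k x) \<and> card (down k v) = card (up k x))" if v: "v \<in> V" for v
  proof -
    obtain g where g: "aut g" "g x = v" using aut_ex[OF xy(1) v] by blast
    have card: "card (g ` up k x) = card (up k x)" "card (g ` down k x) = card (down k x)"
      by (intro card_image_nb[OF g(1) xy(1)]; blast)+
    from inv g(1) consider "\<forall>u\<in>V. \<forall>w\<in>V. k (g u) - k (g w) = k u - k w"
      | "\<forall>u\<in>V. \<forall>w\<in>V. k (g u) - k (g w) = k w - k u"
      unfolding flip_invariant_def by blast
    then show ?thesis
    proof cases
      case 1
      from up_down_image[OF g(1) xy(1) this] card show ?thesis unfolding g(2) by simp
    next
      case 2
      from up_down_image_flip[OF g(1) xy(1) this] card show ?thesis unfolding g(2) by simp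
    qed
  qed
  have "\<exists>b\<in>nb x. 0 < k b - k x" using edge by auto
  \<comment> \<open>The upper neighbour \<open>y\<close> has to be balanced in the sum, so
    harmonicity forces a lower one.\<close>
  moreover have "\<exists>b\<in>nb x. 0 < - (k b - k x)"
  proof (rule sum_zero_pos[OF finite_nb, where f = "\<lambda>b. - (k b - k x)" and a = y])
    show "(\<Sum>w\<in>nb x. - (k w - k x)) = 0"
      unfolding sum_negf using harm xy by (simp add: harmonic_def)
  qed (use edge in auto)
  ultimately have "up k x \<noteq> {}" "down k x \<noteq> {}" by auto
  then have pos: "0 < card (up k x)" "0 < card (down k x)"
    using finite_up finite_down card_gt_0_iff by blast+
  consider (level) u w where "{u, w} \<in> E" "k u = k w"
    | (two) "2 \<le> card (up k x)" "2 \<le> card (down k x)"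
    | (up) "\<And>v w. {v, w} \<in> E \<Longrightarrow> k v \<noteq> k w" "2 \<le> card (up k x)" "card (down k x) = 1"
    | (down) "\<And>v w. {v, w} \<in> E \<Longrightarrow> k v \<noteq> k w" "2 \<le> card (down k x)" "card (up k x) = 1"
    | (path) "\<And>v w. {v, w} \<in> E \<Longrightarrow> k v \<noteq> k w" "card (up k x) = 1" "card (down k x) = 1"
  proof -
    have "2 \<le> card (up k x) \<or> card (up k x) = 1" "2 \<le> card (down k x) \<or> card (down k x) = 1"
      using pos by linarith+
    then show thesis using that by blast
  qed
  then show ?thesis
  proof cases
    case level
    show ?thesis
    proof (rule growth_level[of k])
      fix v assume v: "v \<in> V"
      have "0 < card (up k v)" using cards[OF v] pos by auto
      then have "up k v \<noteq> {}" by (metis card.empty less_numeral_extra(3))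
      then show "\<exists>x\<in>nb v. k v < k x" by blast
      have uw: "u \<in> V" "w \<in> V" using level edgeD by blast+
      obtain g where g: "aut g" "g u = v" using aut_ex[OF uw(1) v] by blast
      have "k (g w) - k (g u) = k w - k u \<or> k (g w) - k (g u) = k u - k w"
        using inv g(1) uw unfolding flip_invariant_def by blast
      then have "k (g w) = k v" using level g by auto
      moreover have "{v, g w} \<in> E" using aut_edge[OF g(1) uw] level g by simp
      ultimately show "\<exists>x\<in>nb v. k x = k v" by blast
    qed
  next
    case two
    show ?thesis
    proof (rule growth_two_up[of k])
      fix v assume v: "v \<in> V"
      have "2 \<le> card (up k v)" using cards[OF v] two by linarith
      then show "\<exists>x\<in>nb v. \<exists>y\<in>nb v. x \<noteq> y \<and> k v < k x \<and> k v < k y"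
        by (rule card_ge_2_obtain) blast
    qed
  next
    case up
    then show ?thesis by (rule growth_alternating_case[OF inv harm _ xy(1)])
  next
    case down
    have "flip_invariant (\<lambda>v. - k v)"
      unfolding flip_invariant_def
    proof (intro allI impI)
      fix g assume "aut g"
      then have "(\<forall>u\<in>V. \<forall>w\<in>V. k (g u) - k (g w) = k u - k w) \<or> (\<forall>u\<in>V. \<forall>w\<in>V. k (g u) - k (g w) = k w - k u)"
        using inv by (simp add: flip_invariant_def)
      then show "(\<forall>u\<in>V. \<forall>w\<in>V. - k (g u) - - k (g w) = - k u - - k w)
          \<or> (\<forall>u\<in>V. \<forall>w\<in>V. - k (g u) - - k (g w) = - k w - - k u)"
        by (smt (verit))
    qed
    moreover have "harmonic (\<lambda>v. - k v)"
      unfolding harmonic_def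
    proof
      fix v assume "v \<in> V"
      then have "(\<Sum>w\<in>nb v. k w - k v) = 0" using harm by (simp add: harmonic_def)
      moreover have "(\<Sum>w\<in>nb v. - k w - - k v) = - (\<Sum>w\<in>nb v. k w - k v)"
        by (simp flip: sum_negf)
      ultimately show "(\<Sum>w\<in>nb v. - k w - - k v) = 0" by simp
    qed
    ultimately show ?thesis
      by (rule growth_alternating_case[OF _ _ _ xy(1)]) (use down in auto)
  next
    case path
    have False using path(2,3) cards by (intro path_or_branch[OF not_path path(1)]) auto
    then show ?thesis ..
  qed
qed

text \<open>The Laplacian \<open>L\<close> of \<open>h\<close> inherits the sign changes but not the
  additive constants, so its absolute value is the same everywhere. If it is not zero, the sign
  \<tau> of \<open>L\<close> records which automorphisms flip.\<close>

lemma two_ended_growth: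
  assumes not_path: "\<not> isomorphic_graphs V E (UNIV :: int set) two_way_path_edges"
    and two: "two_ended V E"
  shows golden_growth
proof -
  obtain h :: "'a \<Rightarrow> real" where
    inv: "\<And>g. aut g \<Longrightarrow> \<exists>\<epsilon>\<in>{1, -1}. \<forall>u\<in>V. \<forall>w\<in>V. h (g u) - h (g w) = \<epsilon> * (h u - h w)"
    and desc: "\<And>u. u \<in> V \<Longrightarrow> \<exists>v\<in>V. h v < h u"
    using two_ended_height[OF two] by blast
  \<comment> \<open>Three heights, for the last case: adding a multiple of \<tau> may merge two of
    them, but two of the three vertices carry the same sign and stay apart.\<close>
  obtain p q r where pqr: "p \<in> V" "q \<in> V" "r \<in> V" "h q < h p" "h r < h q"
    using V_nonempty desc by blast
  define L where "L v = (\<Sum>w\<in>nb v. h w - h v)" for v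
  have sum_nb: "(\<Sum>w\<in>nb (g v). f w) = (\<Sum>w\<in>nb v. f (g w))" if "aut g" "v \<in> V"
    for g v and f :: "'a \<Rightarrow> real"
    unfolding aut_nb[OF that] using nb_V by (subst sum.reindex) (auto intro: inj_on_subset[OF aut_inj[OF that(1)]])
  have L_aut: "L (g v) = \<epsilon> * L v"
    if "aut g" "v \<in> V" "\<forall>u\<in>V. \<forall>w\<in>V. h (g u) - h (g w) = \<epsilon> * (h u - h w)" for g v \<epsilon>
    unfolding L_def sum_nb[OF that(1,2)] sum_distrib_left
    using that(2,3) nb_V by (intro sum.cong) auto
  show ?thesis
  proof (cases "L p = 0")
    case True
    have "L v = 0" if v: "v \<in> V" for v
    proof -
      obtain g where g: "aut g" "g p = v" using aut_ex[OF pqr(1) v] by blast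
      obtain \<epsilon> where "\<forall>u\<in>V. \<forall>w\<in>V. h (g u) - h (g w) = \<epsilon> * (h u - h w)"
        using inv[OF g(1)] by blast
      from L_aut[OF g(1) pqr(1) this] show ?thesis using True g(2) by simp
    qed
    then have "harmonic h" by (simp add: harmonic_def L_def)
    moreover have "flip_invariant h"
      unfolding flip_invariant_def
    proof (intro allI impI)
      fix g assume "aut g"
      then obtain \<epsilon> where "\<epsilon> \<in> {1, -1}" "\<forall>u\<in>V. \<forall>w\<in>V. h (g u) - h (g w) = \<epsilon> * (h u - h w)"
        using inv by blast
      then show "(\<forall>u\<in>V. \<forall>w\<in>V. h (g u) - h (g w) = h u - h w)
          \<or> (\<forall>u\<in>V. \<forall>w\<in>V. h (g u) - h (g w) = h w - h u)"
        by auto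
    qed
    moreover obtain x y where "{x, y} \<in> E" "h x < h y"
      using nonconstant_edge[of p q h] pqr by auto
    ultimately show ?thesis by (intro growth_harmonic_case[OF not_path])
  next
    case False
    define \<tau> where "\<tau> v = sgn (L v)" for v
    define \<delta> where "\<delta> = \<bar>L p\<bar>"
    define opp where "opp v = {w \<in> nb v. \<tau> w \<noteq> \<tau> v}" for v
    have abs: "\<bar>L v\<bar> = \<delta>" if v: "v \<in> V" for v
    proof -
      obtain g where g: "aut g" "g p = v" using aut_ex[OF pqr(1) v] by blast
      obtain \<epsilon> where \<epsilon>: "\<epsilon> \<in> {1, -1}" "\<forall>u\<in>V. \<forall>w\<in>V. h (g u) - h (g w) = \<epsilon> * (h u - h w)"
        using inv[OF g(1)] by blast
      from L_aut[OF g(1) pqr(1) \<epsilon>(2)] show ?thesis using \<epsilon>(1) g(2) by (auto simp: \<delta>_def)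
    qed
    have L_eq: "L v = \<delta> * \<tau> v" and \<tau>: "\<tau> v = 1 \<or> \<tau> v = -1" if "v \<in> V" for v
      using abs[OF that] False by (auto simp: \<tau>_def \<delta>_def sgn_if)
    have \<tau>_aut: "\<tau> (g v) = \<epsilon> * \<tau> v"
      if "aut g" "v \<in> V" "\<epsilon> \<in> {1, -1}" "\<forall>u\<in>V. \<forall>w\<in>V. h (g u) - h (g w) = \<epsilon> * (h u - h w)" for g v \<epsilon>
      using L_aut[OF that(1,2,4)] that(3) by (auto simp: \<tau>_def sgn_minus)
    have opp_card: "card (opp v) = card (opp p)" if v: "v \<in> V" for v
    proof -
      obtain g where g: "aut g" "g p = v" using aut_ex[OF pqr(1) v] by blast
      obtain \<epsilon> where \<epsilon>: "\<epsilon> \<in> {1, -1}" "\<forall>u\<in>V. \<forall>w\<in>V. h (g u) - h (g w) = \<epsilon> * (h u - h w)"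
        using inv[OF g(1)] by blast
      have "opp (g p) = g ` opp p"
        unfolding opp_def
      proof (rule Collect_nb_image[OF g(1) pqr(1)])
        fix w assume "w \<in> nb p"
        then have "w \<in> V" using nb_V by blast
        then show "\<tau> (g w) \<noteq> \<tau> (g p) \<longleftrightarrow> \<tau> w \<noteq> \<tau> p"
          using \<tau>_aut[OF g(1) _ \<epsilon>] pqr(1) \<epsilon>(1) by auto
      qed
      then show ?thesis using card_image_nb[OF g(1) pqr(1), of "opp p"] g(2) by (auto simp: opp_def)
    qed
    have fin_opp: "finite (opp v)" for v unfolding opp_def using finite_nb[of v] by simp
    show ?thesis
    proof (cases "card (opp p) = 0")
      case True
      then have none: "opp v = {}" if "v \<in> V" for v using opp_card[OF that] fin_opp by simp
      have const: "\<tau> v = \<tau> p" if "v \<in> V" for v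
        using pqr(1) that
      proof (induction rule: connected_induct)
        case (step x y)
        have "y \<notin> opp x" using none edgeD[OF step(1)] by blast
        then show ?case using step by (simp add: opp_def)
      qed simp
      have inv1: "\<forall>u\<in>V. \<forall>w\<in>V. h (g u) - h (g w) = h u - h w" if g: "aut g" for g
      proof -
        obtain \<epsilon> where \<epsilon>: "\<epsilon> \<in> {1, -1}" "\<forall>u\<in>V. \<forall>w\<in>V. h (g u) - h (g w) = \<epsilon> * (h u - h w)"
          using inv[OF g] by blast
        \<comment> \<open>An automorphism that flips \<open>h\<close> would also flip \<tau>, which
          is constant here.\<close>
        have "\<tau> p = \<epsilon> * \<tau> p" using \<tau>_aut[OF g pqr(1) \<epsilon>] const[OF aut_in[OF g pqr(1)]] by simp
        then have "\<epsilon> = 1" using \<tau>[OF pqr(1)] by auto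
        then show ?thesis using \<epsilon>(2) by simp
      qed
      obtain x y where xy: "{x, y} \<in> E" "h x < h y"
        using nonconstant_edge[of p q h] pqr by auto
      show ?thesis by (rule growth_translation_case[OF not_path _ xy]) (rule inv1)
    next
      case m: False
      \<comment> \<open>Both \<open>L\<close> and the Laplacian of \<open>\<tau>\<close> are multiples of \<open>\<tau>\<close>, so a multiple of \<open>\<tau>\<close> makes \<open>h\<close> harmonic.\<close>
      define t where "t = \<delta> / (2 * real (card (opp p)))"
      define k where "k v = h v + t * \<tau> v" for v
      have "harmonic k"
        unfolding harmonic_def
      proof
        fix v assume v: "v \<in> V"
        have "(\<Sum>w\<in>nb v. \<tau> w - \<tau> v) = (\<Sum>w\<in>opp v. \<tau> w - \<tau> v)"
          unfolding opp_def using finite_nb by (intro sum.mono_neutral_right) auto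
        also have "\<dots> = (\<Sum>w\<in>opp v. - 2 * \<tau> v)"
        proof (rule sum.cong)
          fix w assume w: "w \<in> opp v"
          then have "w \<in> V" using nb_V by (auto simp: opp_def)
          then show "\<tau> w - \<tau> v = - 2 * \<tau> v" using \<tau>[of w] \<tau>[OF v] w by (auto simp: opp_def)
        qed simp
        also have "\<dots> = - 2 * real (card (opp p)) * \<tau> v" using opp_card[OF v] by simp
        finally have s: "(\<Sum>w\<in>nb v. \<tau> w - \<tau> v) = - 2 * real (card (opp p)) * \<tau> v" .
        have "(\<Sum>w\<in>nb v. k w - k v) = (\<Sum>w\<in>nb v. (h w - h v) + t * (\<tau> w - \<tau> v))"
          by (intro sum.cong) (auto simp: k_def algebra_simps)
        also have "\<dots> = L v + t * (\<Sum>w\<in>nb v. \<tau> w - \<tau> v)"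
          unfolding sum.distrib L_def sum_distrib_left by simp
        \<comment> \<open>This determines \<open>t\<close>: \<open>L v\<close> is \<delta> times the
          sign, and the Laplacian of the sign is minus twice the number of opposite neighbours times
          the sign.\<close>
        also have "\<dots> = 0" unfolding s L_eq[OF v] t_def using m by simp
        finally show "(\<Sum>w\<in>nb v. k w - k v) = 0" .
      qed
      moreover have "flip_invariant k"
        unfolding flip_invariant_def
      proof (intro allI impI)
        fix g assume g: "aut g"
        obtain \<epsilon> where \<epsilon>: "\<epsilon> \<in> {1, -1}" "\<forall>u\<in>V. \<forall>w\<in>V. h (g u) - h (g w) = \<epsilon> * (h u - h w)"
          using inv[OF g] by blast
        have "k (g u) - k (g w) = \<epsilon> * (k u - k w)" if "u \<in> V" "w \<in> V" for u w
        proof -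
          have "k (g u) - k (g w) = (h (g u) - h (g w)) + t * (\<tau> (g u) - \<tau> (g w))"
            by (simp add: k_def algebra_simps)
          also have "h (g u) - h (g w) = \<epsilon> * (h u - h w)" using \<epsilon>(2) that by blast
          also have "\<tau> (g u) - \<tau> (g w) = \<epsilon> * \<tau> u - \<epsilon> * \<tau> w"
            using \<tau>_aut[OF g that(1) \<epsilon>] \<tau>_aut[OF g that(2) \<epsilon>] by simp
          finally show ?thesis by (simp add: k_def algebra_simps)
        qed
        then show "(\<forall>u\<in>V. \<forall>w\<in>V. k (g u) - k (g w) = k u - k w)
            \<or> (\<forall>u\<in>V. \<forall>w\<in>V. k (g u) - k (g w) = k w - k u)"
          using \<epsilon>(1) by auto
      qed
      moreover obtain x y where "{x, y} \<in> E" "k x < k y"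
      proof -
        have "k p \<noteq> k q \<or> k q \<noteq> k r \<or> k p \<noteq> k r"
          using \<tau>[OF pqr(1)] \<tau>[OF pqr(2)] \<tau>[OF pqr(3)] pqr(4,5) by (auto simp: k_def)
        then show ?thesis using nonconstant_edge[of _ _ k] pqr(1-3) that by blast
      qed
      ultimately show ?thesis by (intro growth_harmonic_case[OF not_path])
    qed
  qed
qed

end

theorem theorem1p3:
  fixes V :: "'a set" and E :: "'a set set"
  assumes "simple_graph V E"
    and "connected_graph V E"
    and "locally_finite_graph V E"
    and "two_ended V E"
    and "vertex_transitive V E"
    and "\<not> isomorphic_graphs V E (UNIV :: int set) two_way_path_edges"
    and "a \<in> V"
  shows "connective_constant V E a \<ge> (1 + sqrt 5) / 2"
proof -
  interpret transitive_graph V E by unfold_locales (use assms in auto)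
  show ?thesis
    using golden_growthD[OF two_ended_growth[OF assms(6,4)] assms(7)] by (simp add: golden_def)
qed

end
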